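(* Let $m$ and $n$ be positive integers, let $\mathcal{A}=\{(a_1,a_2)\in\mathbb{Z}^2: 0\le a_1\le m,\ 0\le a_2\le n\}$, let $c_{ia}$ ($i=1,2,3,4$, $a\in\mathcal{A}$) be indeterminates, and let $F_i=\sum_{a\in\mathcal{A}}c_{ia}x_1^{a_1}x_2^{a_2}$ for $i=1,2,3,4$. Let $F_{m,n}$ be the $4mn\times 4mn$ matrix, in the monomial bases, of the linear map $S_{m-1,n-1}^4\to S_{2m-1,2n-1}$, $(A_1,A_2,A_3,A_4)\mapsto\sum_{i=1}^4A_iF_i$. Then $\det(F_{m,n})$ is an irreducible element of $\mathbb{Z}[c_{ia}]=\mathbb{Z}[c_{ia}: i=1,\dots,4,\ a\in\mathcal{A}]$.
   Context: Let $\mathbb{K}=\mathbb{Q}(c_{ia})_{i=1,\dots,4,\,a\in\mathcal{A}}$ be the field of rational functions in the indeterminates $c_{ia}$, and let $x_1,x_2$ be further indeterminates. For nonnegative integers $i,j$, $S_{i,j}$ denotes the $\mathbb{K}$-vector space spanned by the monomials $x_1^{a_1}x_2^{a_2}$ with $0\le a_1\le i$ and $0\le a_2\le j$; its monomial basis consists of these monomials. The monomial basis of $S_{m-1,n-1}^4$ consists of the quadruples having one entry a monomial of $S_{m-1,n-1}$ and the other entries zero. Both $S_{m-1,n-1}^4$ and $S_{2m-1,2n-1}$ have dimension $4mn$, the entries of $F_{m,n}$ lie in $\mathbb{Z}[c_{ia}]$ (each is $0$ or one of the $c_{ia}$), and $\det(F_{m,n})$ is well defined up to sign (depending on the ordering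 of the bases). *)

theory Defs
  imports
    "HOL-Library.Poly_Mapping"
    "HOL-Library.Product_Plus"
    "HOL-Algebra.Ring_Divisibility"
    "Jordan_Normal_Form.Determinant"
begin

text \<open>
  Polynomials in x1, x2 are finitely supported maps from exponent pairs to coefficients;
  \<open>Poly_Mapping.single a k\<close> is the term \<open>k x1^(fst a) x2^(snd a)\<close>.
\<close>

type_synonym 'k bipoly = "(nat \<times> nat) \<Rightarrow>\<^sub>0 'k"

definition exponents :: "nat \<Rightarrow> nat \<Rightarrow> (nat \<times> nat) set" where
  "exponents i j = {0..i} \<times> {0..j}"

definition S_space :: "nat \<Rightarrow> nat \<Rightarrow> 'k::zero bipoly set" where
  "S_space i j = {p. Poly_Mapping.keys p \<subseteq> exponents i j}"

definition bipoly_with_coeffs :: "nat \<Rightarrow> nat \<Rightarrow> (nat \<times> nat \<Rightarrow> 'k) \<Rightarrow> 'k::comm_ring_1 bipoly" where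
  "bipoly_with_coeffs m n u = (\<Sum>a\<in>exponents m n. Poly_Mapping.single a (u a))"

text \<open>Quadruples are functions on indices, of which only the values at 1, 2, 3, 4 matter.\<close>

definition syl_map :: "(nat \<Rightarrow> 'k bipoly) \<Rightarrow> (nat \<Rightarrow> 'k bipoly) \<Rightarrow> 'k::comm_ring_1 bipoly" where
  "syl_map F A = (\<Sum>i=1..4. A i * F i)"

definition monomial_quad :: "nat \<times> (nat \<times> nat) \<Rightarrow> nat \<Rightarrow> 'k::comm_ring_1 bipoly" where
  "monomial_quad = (\<lambda>(i, a) k. if k = i then Poly_Mapping.single a 1 else 0)"

text \<open>
  The matrix of \<open>syl_map F\<close> in the monomial bases listed by \<open>cs\<close> (domain: \<open>(i, a)\<close> is the
  quadruple with the monomial of exponent \<open>a\<close> in position \<open>i\<close>) and \<open>rs\<close> (codomain); the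
  columns are the coordinate vectors of the images of the basis quadruples.
\<close>

definition syl_mat ::
    "(nat \<Rightarrow> 'k bipoly) \<Rightarrow> (nat \<times> nat) list \<Rightarrow> (nat \<times> (nat \<times> nat)) list \<Rightarrow> 'k::comm_ring_1 mat" where
  "syl_mat F rs cs = mat (length rs) (length cs)
     (\<lambda>(r, s). Poly_Mapping.lookup (syl_map F (monomial_quad (cs ! s))) (rs ! r))"

definition is_enumeration :: "'a list \<Rightarrow> 'a set \<Rightarrow> bool" where
  "is_enumeration xs X \<longleftrightarrow> distinct xs \<and> set xs = X"

text \<open>
  Integer polynomials in the indeterminates \<open>c_(i,a)\<close> for all natural \<open>i\<close> and all exponent
  pairs \<open>a\<close>. The ring \<open>Zc m n\<close> is the subring in which only the \<open>c_(i,a)\<close> with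
  \<open>i \<in> {1..4}\<close> and \<open>a \<in> exponents m n\<close> occur.
\<close>

type_synonym zpoly = "((nat \<times> (nat \<times> nat)) \<Rightarrow>\<^sub>0 nat) \<Rightarrow>\<^sub>0 int"

definition indet :: "nat \<Rightarrow> nat \<times> nat \<Rightarrow> zpoly" where
  "indet i a = Poly_Mapping.single (Poly_Mapping.single (i, a) 1) 1"

definition Zc :: "nat \<Rightarrow> nat \<Rightarrow> zpoly ring" where
  "Zc m n = \<lparr> carrier = {p. \<forall>t\<in>Poly_Mapping.keys p. Poly_Mapping.keys t \<subseteq> {1..4} \<times> exponents m n},
     monoid.mult = (*), one = 1, ring.zero = 0, add = (+) \<rparr>"

definition generic_poly :: "nat \<Rightarrow> nat \<Rightarrow> nat \<Rightarrow> zpoly bipoly" where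
  "generic_poly m n i = bipoly_with_coeffs m n (indet i)"

text \<open>
  The coefficient ring is a parameter of the map and its matrix. Over every commutative ring,
  \<open>syl_map_in_S_space\<close> and \<open>syl_mat_represents\<close> say that \<open>syl_mat\<close> represents the map
  \<open>S_space (m - 1) (n - 1)^4 \<rightarrow> S_space (2 * m - 1) (2 * n - 1)\<close>, and \<open>syl_mat_entry\<close> says
  that each entry is 0 or one of the coefficients. So the matrix over the field of rational
  functions in the indeterminates is the one over the polynomial ring.
\<close>

lemma lookup_bipoly_with_coeffs:
  "Poly_Mapping.lookup (bipoly_with_coeffs m n u) b = (if b \<in> exponents m n then u b else 0)"
proof -
  have fin: "finite (exponents m n)" by (simp add: exponents_def)
  have "Poly_Mapping.lookup (bipoly_with_coeffs m n u) b
      = (\<Sum>a\<in>exponents m n. if a = b then u a else 0)"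
    unfolding bipoly_with_coeffs_def lookup_sum
    by (intro sum.cong) (auto simp: lookup_single when_def)
  also have "\<dots> = (if b \<in> exponents m n then u b else 0)"
    using fin by (simp add: sum.delta)
  finally show ?thesis .
qed

lemma syl_map_monomial_quad:
  assumes "i \<in> {1..4}"
  shows "syl_map F (monomial_quad (i, a)) = Poly_Mapping.single a 1 * F i"
proof -
  have "syl_map F (monomial_quad (i, a))
      = (\<Sum>k\<in>{1..4}. if k = i then Poly_Mapping.single a 1 * F k else 0)"
    unfolding syl_map_def monomial_quad_def by (intro sum.cong) auto
  then show ?thesis using assms by (simp add: sum.delta)
qed

lemma lookup_single_times:
  fixes p :: "'k::comm_ring_1 bipoly"
  shows "Poly_Mapping.lookup (Poly_Mapping.single a k * p) b
    = (if fst a \<le> fst b \<and> snd a \<le> snd b then k * Poly_Mapping.lookup p (b - a) else 0)"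
proof -
  have iff: "b = a + q \<longleftrightarrow> fst a \<le> fst b \<and> snd a \<le> snd b \<and> q = b - a" for q
    by (cases a; cases b; cases q) auto
  have "Poly_Mapping.lookup (Poly_Mapping.single a k * p) b
      = (\<Sum>l. Poly_Mapping.lookup (Poly_Mapping.single a k) l *
          (\<Sum>q. (Poly_Mapping.lookup p q when b = l + q)))"
    by (simp add: times_poly_mapping.rep_eq prod_fun_def)
  also have "\<dots> = (\<Sum>l. (k * (\<Sum>q. (Poly_Mapping.lookup p q when b = a + q))) when l = a)"
    by (intro Sum_any.cong) (auto simp: lookup_single when_def)
  also have "\<dots> = k * (\<Sum>q. (Poly_Mapping.lookup p q when b = a + q))"
    by simp
  also have "(\<Sum>q. (Poly_Mapping.lookup p q when b = a + q))
      = (\<Sum>q. ((Poly_Mapping.lookup p (b - a)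
            when fst a \<le> fst b \<and> snd a \<le> snd b) when q = b - a))"
    by (intro Sum_any.cong) (auto simp: iff when_def)
  finally show ?thesis by (simp add: when_def)
qed

lemma syl_mat_entry:
  assumes "r < length rs" "s < length cs" "cs ! s = (i, a)" "i \<in> {1..4}"
  shows "syl_mat (\<lambda>i. bipoly_with_coeffs m n (u i)) rs cs $$ (r, s)
    = (if fst a \<le> fst (rs ! r) \<and> snd a \<le> snd (rs ! r) \<and> rs ! r - a \<in> exponents m n
       then u i (rs ! r - a) else 0)"
  using assms
  by (simp add: syl_mat_def syl_map_monomial_quad lookup_single_times lookup_bipoly_with_coeffs)

lemma length_bases:
  assumes "0 < m" "0 < n"
  shows "is_enumeration rs (exponents (2 * m - 1) (2 * n - 1)) \<Longrightarrow> length rs = 4 * m * n"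
    and "is_enumeration cs ({1..4::nat} \<times> exponents (m - 1) (n - 1)) \<Longrightarrow> length cs = 4 * m * n"
  using assms
  by (auto simp: is_enumeration_def exponents_def distinct_card[symmetric] card_cartesian_product)

lemma bipoly_expand:
  assumes "p \<in> S_space i j"
  shows "p = (\<Sum>a\<in>exponents i j. Poly_Mapping.single a (Poly_Mapping.lookup p a))"
proof (rule poly_mapping_eqI)
  fix b
  have "Poly_Mapping.lookup p b = 0" if "b \<notin> exponents i j"
    using assms that by (auto simp: S_space_def in_keys_iff)
  then show "Poly_Mapping.lookup p b = Poly_Mapping.lookup
      (\<Sum>a\<in>exponents i j. Poly_Mapping.single a (Poly_Mapping.lookup p a)) b"
    by (auto simp: lookup_sum lookup_single when_def exponents_def)
qed

lemma syl_mat_represents: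
  fixes A :: "nat \<Rightarrow> 'k::comm_ring_1 bipoly"
  assumes A: "\<And>i. i \<in> {1..4} \<Longrightarrow> A i \<in> S_space (m - 1) (n - 1)"
    and cs: "is_enumeration cs ({1..4} \<times> exponents (m - 1) (n - 1))"
    and r: "r < length rs"
  shows "Poly_Mapping.lookup (syl_map F A) (rs ! r)
    = (syl_mat F rs cs *\<^sub>v vec (length cs)
        (\<lambda>s. Poly_Mapping.lookup (A (fst (cs ! s))) (snd (cs ! s)))) $ r"
proof -
  let ?E = "exponents (m - 1) (n - 1)"
  let ?g = "\<lambda>x. Poly_Mapping.lookup (syl_map F (monomial_quad x)) (rs ! r) *
      Poly_Mapping.lookup (A (fst x)) (snd x)"
  have summand: "Poly_Mapping.lookup (A i * F i) (rs ! r) = (\<Sum>a\<in>?E. ?g (i, a))"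
    if i: "i \<in> {1..4}" for i
  proof -
    have "A i * F i = (\<Sum>a\<in>?E. Poly_Mapping.single a (Poly_Mapping.lookup (A i) a)) * F i"
      using bipoly_expand[OF A[OF i]] by simp
    then have "Poly_Mapping.lookup (A i * F i) (rs ! r) = (\<Sum>a\<in>?E. Poly_Mapping.lookup
        (Poly_Mapping.single a (Poly_Mapping.lookup (A i) a) * F i) (rs ! r))"
      by (simp only: sum_distrib_right lookup_sum)
    also have "\<dots> = (\<Sum>a\<in>?E. ?g (i, a))"
      using i by (intro sum.cong) (simp_all add: lookup_single_times syl_map_monomial_quad)
    finally show ?thesis .
  qed
  have "Poly_Mapping.lookup (syl_map F A) (rs ! r) = (\<Sum>i=1..4. \<Sum>a\<in>?E. ?g (i, a))"
    by (subst syl_map_def) (simp only: lookup_sum summand cong: sum.cong)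
  also have "\<dots> = (\<Sum>x\<in>{1..4} \<times> ?E. ?g x)"
    by (simp add: sum.cartesian_product split_beta)
  also have "\<dots> = (\<Sum>s<length cs. ?g (cs ! s))"
    using cs by (intro sum.reindex_bij_betw[symmetric] bij_betw_nth) (auto simp: is_enumeration_def)
  also have "\<dots> = (syl_mat F rs cs *\<^sub>v vec (length cs)
        (\<lambda>s. Poly_Mapping.lookup (A (fst (cs ! s))) (snd (cs ! s)))) $ r"
    using r by (simp add: syl_mat_def scalar_prod_def atLeast0LessThan)
  finally show ?thesis .
qed

lemma syl_map_in_S_space:
  assumes "0 < m" "0 < n"
    and A: "\<And>i. i \<in> {1..4} \<Longrightarrow> A i \<in> S_space (m - 1) (n - 1)"
  shows "syl_map (\<lambda>i. bipoly_with_coeffs m n (u i)) A \<in> S_space (2 * m - 1) (2 * n - 1)"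
proof -
  have F: "Poly_Mapping.keys (bipoly_with_coeffs m n (u i)) \<subseteq> exponents m n" for i
    by (auto simp: in_keys_iff lookup_bipoly_with_coeffs split: if_splits)
  have "b \<in> exponents (2 * m - 1) (2 * n - 1)"
    if i: "i \<in> {1..4}" and b: "b \<in> Poly_Mapping.keys (A i * bipoly_with_coeffs m n (u i))" for i b
  proof -
    obtain p q where "b = p + q" "p \<in> Poly_Mapping.keys (A i)"
        "q \<in> Poly_Mapping.keys (bipoly_with_coeffs m n (u i))"
      using b keys_mult by blast
    then have "b = p + q" "p \<in> exponents (m - 1) (n - 1)" "q \<in> exponents m n"
      using A[OF i] F by (auto simp: S_space_def)
    then show ?thesis using assms(1,2) by (auto simp: exponents_def)
  qed
  moreover have "Poly_Mapping.keys (syl_map (\<lambda>i. bipoly_with_coeffs m n (u i)) A)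
      \<subseteq> (\<Union>i\<in>{1..4}. Poly_Mapping.keys (A i * bipoly_with_coeffs m n (u i)))"
    unfolding syl_map_def by (rule keys_sum)
  ultimately show ?thesis unfolding S_space_def by blast
qed

lemma cring_Zc: "cring (Zc m n)"
proof -
  have add: "p + q \<in> carrier (Zc m n)" and neg: "- p \<in> carrier (Zc m n)"
    if "p \<in> carrier (Zc m n)" "q \<in> carrier (Zc m n)" for p q
    using that keys_add[of p q] by (auto simp: Zc_def)
  have mult: "p * q \<in> carrier (Zc m n)"
    if p: "p \<in> carrier (Zc m n)" and q: "q \<in> carrier (Zc m n)" for p q
  proof -
    have "Poly_Mapping.keys t \<subseteq> {1..4} \<times> exponents m n" if t: "t \<in> Poly_Mapping.keys (p * q)" for t
    proof -
      obtain v w where "t = v + w" "v \<in> Poly_Mapping.keys p" "w \<in> Poly_Mapping.keys q"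
        using keys_mult[of p q] t by blast
      then show ?thesis using p q keys_add[of v w] by (fastforce simp: Zc_def)
    qed
    then show ?thesis by (simp add: Zc_def)
  qed
  have one: "(1::zpoly) \<in> carrier (Zc m n)" and zero: "(0::zpoly) \<in> carrier (Zc m n)"
    by (auto simp: Zc_def simp flip: single_one)
  have ops: "x \<otimes>\<^bsub>Zc m n\<^esub> y = x * y" "x \<oplus>\<^bsub>Zc m n\<^esub> y = x + y" "\<one>\<^bsub>Zc m n\<^esub> = 1" "\<zero>\<^bsub>Zc m n\<^esub> = 0" for x y
    by (auto simp: Zc_def)
  show ?thesis
  proof (rule cringI)
    show "abelian_group (Zc m n)"
    proof (rule abelian_groupI; unfold ops)
      fix x assume "x \<in> carrier (Zc m n)"
      then show "\<exists>y\<in>carrier (Zc m n). y + x = 0"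
        by (intro bexI[of _ "- x"]) (auto intro: neg)
    qed (auto intro: add zero simp: ac_simps)
    show "Group.comm_monoid (Zc m n)"
      by (rule comm_monoidI; unfold ops) (auto intro: mult one simp: ac_simps)
  qed (auto simp: ops algebra_simps)
qed

end

theory Submission
  imports Defs "HOL-Library.Product_Lexorder"
begin

text \<open>
  Write \<open>D\<close> for the determinant, \<open>x, y\<close> for \<open>x1, x2\<close>, and let \<open>D = P * Q\<close>. Two principles transfer information from
  \<open>D\<close> to its factors. A factor of a polynomial that is homogeneous for a weight on the
  monomials is homogeneous for that weight (\<open>factor_homogeneous\<close>). Setting the indeterminates
  outside a set \<open>V\<close> to 0 is a ring homomorphism, so if a single monomial of \<open>D\<close> lives on \<open>V\<close>,
  then the same holds for \<open>P\<close> and for \<open>Q\<close> (\<open>factor_of_term_in\<close>).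

  \<open>D\<close> is homogeneous for the degree in the coefficients of each \<open>F\<^sub>i\<close> and for the \<open>x\<close>- and
  \<open>y\<close>-degrees, which give \<open>c_(i,a)\<close> the weights \<open>fst a\<close> and \<open>snd a\<close>. Let \<open>k\<^sub>i\<close> be the degree of
  \<open>P\<close> in the coefficients of \<open>F\<^sub>i\<close>. If every \<open>F\<^sub>i\<close> is replaced by its term at one of the four corners
  \<open>1, x^m, y^n, x^m y^n\<close>, each corner used once, then \<open>D\<close> becomes a monomial up to sign, hence so does
  \<open>P\<close>, and its \<open>x\<close>-degree is \<open>m (k\<^sub>i + k\<^sub>j)\<close> where \<open>F\<^sub>i\<close> and \<open>F\<^sub>j\<close> received the two corners with
  \<open>x^m\<close>. As any two polynomials may receive them, all \<open>k\<^sub>i\<close> are equal to one \<open>k\<close>, and \<open>P\<close> has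
  \<open>x\<close>-degree \<open>2 m k\<close> and \<open>y\<close>-degree \<open>2 n k\<close> (\<open>factor_degrees\<close>).

  The decisive specialization is
  \<open>F\<^sub>1 = u0 + u1 y^n + u2 x^m\<close>, \<open>F\<^sub>2 = v0 + v1 y + v2 x^m y^n\<close>, \<open>F\<^sub>3 = w3 x\<close>,
  \<open>F\<^sub>4 = w4 x y^n\<close>. It turns \<open>D\<close>, up to sign, into
  \<open>(u2 v2)^((m-1)n) (w3 w4)^(mn) u1^(n-1) (u0 v1^n \<plusminus> u1 v0^n)\<close>, whose last factor is in essence
  the resultant of \<open>u0 + u1 y^n\<close> and \<open>v0 + v1 y\<close>. As it is linear in \<open>u0\<close>, one of \<open>P\<close> and \<open>Q\<close>
  specializes to a polynomial without \<open>u0\<close>, which therefore divides both terms. So that factor,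
  say \<open>P\<close>, has a monomial in \<open>u1, u2, v2, w3, w4\<close> alone (\<open>factor_core_term\<close>). Its degrees are known:
  \<open>v2\<close>, \<open>w3\<close> and \<open>w4\<close> occur to the power \<open>k\<close>, the \<open>y\<close>-degree leaves no room for \<open>u1\<close>, so \<open>u2\<close>
  also occurs to the power \<open>k\<close>, and the \<open>x\<close>-degree is \<open>2 m k + 2 k\<close>. Hence \<open>k = 0\<close>
  (\<open>factor_core_term_degrees\<close>), and \<open>P\<close> is an integer. It divides the coefficients of \<open>D\<close>, one of
  which is \<open>1\<close> or \<open>-1\<close>, so \<open>P\<close> is a unit.

  The monomials of \<open>D\<close> are controlled by the Leibniz formula, whose nonzero products are indexed
  by the bijections called arrangements below.
\<close>

abbreviation (input) "lookup \<equiv> Poly_Mapping.lookup"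
abbreviation (input) "keys \<equiv> Poly_Mapping.keys"
abbreviation (input) "single \<equiv> Poly_Mapping.single"


section \<open>Homogeneous components and faces of a product\<close>

definition part :: "'t set \<Rightarrow> ('t \<Rightarrow>\<^sub>0 'b) \<Rightarrow> ('t \<Rightarrow>\<^sub>0 'b::comm_monoid_add)" where
  "part A p = (\<Sum>t\<in>keys p \<inter> A. single t (lookup p t))"

lemma lookup_part: "lookup (part A p) t = (if t \<in> A then lookup p t else 0)"
proof -
  have "lookup (part A p) t = (\<Sum>s\<in>keys p \<inter> A. if s = t then lookup p s else 0)"
    unfolding part_def lookup_sum by (intro sum.cong) (auto simp: lookup_single when_def)
  then show ?thesis by (auto simp: sum.delta in_keys_iff)
qed

lemma keys_part: "keys (part A p) = keys p \<inter> A"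
  by (auto simp: in_keys_iff lookup_part split: if_splits)

lemma part_add: "part A (p + q) = part A p + part A q"
  by (rule poly_mapping_eqI) (simp add: lookup_part lookup_add)

lemma part_eq_self: "keys p \<subseteq> A \<Longrightarrow> part A p = p"
  by (rule poly_mapping_eqI) (auto simp: lookup_part in_keys_iff)

lemma part_eq_zero: "keys p \<inter> A = {} \<Longrightarrow> part A p = 0"
  by (rule poly_mapping_eqI) (auto simp: lookup_part in_keys_iff)

text \<open>
  The hypothesis says that \<open>A\<close> cuts out a face of the support of the product: a sum of two
  monomials lies in it only if both summands lie in prescribed faces. Then the three products that
  involve a complementary part have no monomial in \<open>A\<close>.
\<close>

lemma part_times:
  fixes p q :: "'t::monoid_add \<Rightarrow>\<^sub>0 'b::comm_ring"
  assumes face: "\<And>s t. s \<in> keys p \<Longrightarrow> t \<in> keys q \<Longrightarrow> s + t \<in> A \<longleftrightarrow> s \<in> B \<and> t \<in> C"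
  shows "part A (p * q) = part B p * part C q"
proof -
  let ?p = "part B p" and ?p' = "part (- B) p" and ?q = "part C q" and ?q' = "part (- C) q"
  have p: "p = ?p + ?p'" and q: "q = ?q + ?q'"
    by (rule poly_mapping_eqI, simp add: lookup_part lookup_add)+
  have "p * q = ?p * ?q + (?p * ?q' + (?p' * ?q + ?p' * ?q'))"
    by (subst p, subst q) (simp add: algebra_simps)
  then have "part A (p * q)
      = part A (?p * ?q) + (part A (?p * ?q') + (part A (?p' * ?q) + part A (?p' * ?q')))"
    by (simp only: part_add)
  also have "part A (?p * ?q) = ?p * ?q"
    by (rule part_eq_self) (use keys_mult[of ?p ?q] face in \<open>fastforce simp: keys_part\<close>)
  also have "part A (?p * ?q') = 0"
    by (rule part_eq_zero) (use keys_mult[of ?p ?q'] face in \<open>fastforce simp: keys_part\<close>)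
  also have "part A (?p' * ?q) = 0"
    by (rule part_eq_zero) (use keys_mult[of ?p' ?q] face in \<open>fastforce simp: keys_part\<close>)
  also have "part A (?p' * ?q') = 0"
    by (rule part_eq_zero) (use keys_mult[of ?p' ?q'] face in \<open>fastforce simp: keys_part\<close>)
  finally show ?thesis by simp
qed

text \<open>
  The components of highest weight multiply to a nonzero polynomial because the ring has no zero
  divisors (a consequence of a linear order on the monomials, which for the indeterminates \<open>c_(i,a)\<close>
  comes from the lexicographic order of the indices); any of its monomials is a sum of two monomials of highest weight.
\<close>

lemma top_weight_term:
  fixes p q :: "'t::{ordered_cancel_comm_monoid_add, linorder} \<Rightarrow>\<^sub>0 'b::idom"
    and w :: "'t \<Rightarrow> int"
  assumes w: "\<And>s t. w (s + t) = w s + w t" and nz: "p \<noteq> 0" "q \<noteq> 0"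
  shows "\<exists>s\<in>keys p. \<exists>t\<in>keys q. s + t \<in> keys (p * q) \<and>
    (\<forall>s'\<in>keys p. w s' \<le> w s) \<and> (\<forall>t'\<in>keys q. w t' \<le> w t)"
proof -
  have ne: "keys p \<noteq> {}" "keys q \<noteq> {}" using nz by auto
  define a b where "a = Max (w ` keys p)" and "b = Max (w ` keys q)"
  have le: "s \<in> keys p \<Longrightarrow> w s \<le> a" "t \<in> keys q \<Longrightarrow> w t \<le> b" for s t
    by (auto simp: a_def b_def)
  have "a \<in> w ` keys p" "b \<in> w ` keys q"
    using ne by (auto simp: a_def b_def simp del: image_eqI intro!: Max_in)
  then have "part {s. w s = a} p \<noteq> 0" "part {t. w t = b} q \<noteq> 0"
    by (auto simp flip: keys_eq_empty simp: keys_part)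
  moreover have "part {u. w u = a + b} (p * q) = part {s. w s = a} p * part {t. w t = b} q"
  proof (rule part_times)
    fix s t assume "s \<in> keys p" "t \<in> keys q"
    then have "w s \<le> a" "w t \<le> b" using le by auto
    then show "s + t \<in> {u. w u = a + b} \<longleftrightarrow> s \<in> {s. w s = a} \<and> t \<in> {t. w t = b}"
      by (auto simp: w)
  qed
  ultimately have "part {u. w u = a + b} (p * q) \<noteq> 0" by simp
  then have "keys (p * q) \<inter> {u. w u = a + b} \<noteq> {}"
    by (metis keys_part keys_eq_empty)
  then obtain u where u: "u \<in> keys (p * q)" "w u = a + b" by blast
  obtain s t where st: "u = s + t" "s \<in> keys p" "t \<in> keys q"
    using keys_mult[of p q] u(1) by blast
  have "w s = a" "w t = b" using le(1)[OF st(2)] le(2)[OF st(3)] u(2) by (auto simp: st w)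
  then show ?thesis using st u(1) le by blast
qed

text \<open>
  The sum of the highest weights of the factors and the sum of their lowest weights are both weights
  of monomials of the product. If these agree, each factor has a single weight.
\<close>

lemma factor_homogeneous:
  fixes p q :: "'t::{ordered_cancel_comm_monoid_add, linorder} \<Rightarrow>\<^sub>0 'b::idom"
    and w :: "'t \<Rightarrow> int"
  assumes w: "\<And>s t. w (s + t) = w s + w t" and nz: "p \<noteq> 0" "q \<noteq> 0"
    and hom: "\<And>u. u \<in> keys (p * q) \<Longrightarrow> w u = d"
    and "s \<in> keys p" "t \<in> keys q"
  shows "w s + w t = d"
proof -
  have w': "- w (s + t) = - w s + - w t" for s t by (simp add: w)
  obtain s1 t1 where 1: "s1 \<in> keys p" "t1 \<in> keys q" "s1 + t1 \<in> keys (p * q)"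
    "\<And>s'. s' \<in> keys p \<Longrightarrow> w s' \<le> w s1" "\<And>t'. t' \<in> keys q \<Longrightarrow> w t' \<le> w t1"
    using top_weight_term[of w, OF w nz] by blast
  obtain s0 t0 where 0: "s0 \<in> keys p" "t0 \<in> keys q" "s0 + t0 \<in> keys (p * q)"
    "\<And>s'. s' \<in> keys p \<Longrightarrow> - w s' \<le> - w s0" "\<And>t'. t' \<in> keys q \<Longrightarrow> - w t' \<le> - w t0"
    using top_weight_term[of "\<lambda>t. - w t", OF w' nz] by blast
  have "w s1 + w t1 = d" "w s0 + w t0 = d" using hom[OF 1(3)] hom[OF 0(3)] by (auto simp: w)
  moreover have "w s \<le> w s1" "w s0 \<le> w s" "w t \<le> w t1" "w t0 \<le> w t"
    using 1(4,5) 0(4,5) assms(5,6) by auto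
  ultimately show ?thesis by linarith
qed

text \<open>
  Homogeneity for the exponent of every single indeterminate means being a monomial.
\<close>

lemma factor_of_term:
  fixes p q :: "('v::linorder \<Rightarrow>\<^sub>0 nat) \<Rightarrow>\<^sub>0 'b::idom"
  assumes "keys (p * q) = {u}"
  obtains s t where "keys p = {s}" "keys q = {t}" "s + t = u"
proof -
  have nz: "p \<noteq> 0" "q \<noteq> 0" using assms by auto
  then obtain s t where st: "s \<in> keys p" "t \<in> keys q" by (meson all_not_in_conv keys_eq_empty)
  have sum: "s' + t' = u" if "s' \<in> keys p" "t' \<in> keys q" for s' t'
  proof (rule poly_mapping_eqI)
    fix v
    have "int (lookup s' v) + int (lookup t' v) = int (lookup u v)"
      by (rule factor_homogeneous[of "\<lambda>t. int (lookup t v)", OF _ nz _ that])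
        (auto simp: lookup_add assms)
    then show "lookup (s' + t') v = lookup u v" by (simp add: lookup_add)
  qed
  have "s' = s" if "s' \<in> keys p" for s'
    using sum[OF that st(2)] sum[OF st] by (metis add_right_cancel)
  moreover have "t' = t" if "t' \<in> keys q" for t'
    using sum[OF st(1) that] sum[OF st] by (metis add_left_cancel)
  ultimately have "keys p = {s}" "keys q = {t}" using st by blast+
  then show thesis using that sum[OF st] by simp
qed

definition weight :: "('v \<Rightarrow> int) \<Rightarrow> ('v \<Rightarrow>\<^sub>0 nat) \<Rightarrow> int" where
  "weight f t = (\<Sum>v\<in>keys t. int (lookup t v) * f v)"

lemma weight_zero [simp]: "weight f 0 = 0"
  by (simp add: weight_def)

lemma weight_add: "weight f (s + t) = weight f s + weight f t"
  unfolding weight_def by (rule setsum_keys_plus_distrib) (auto simp: distrib_right)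

lemma weight_single: "weight f (single v k) = int k * f v"
  by (simp add: weight_def)

lemma weight_sum: "weight f (\<Sum>b\<in>B. g b) = (\<Sum>b\<in>B. weight f (g b))"
  by (induction B rule: infinite_finite_induct) (auto simp: weight_add)

lemma weight_on:
  assumes "finite V" "keys t \<subseteq> V"
  shows "weight f t = (\<Sum>v\<in>V. int (lookup t v) * f v)"
  unfolding weight_def using assms by (intro sum.mono_neutral_left) (auto simp: in_keys_iff)

definition terms_in :: "'v set \<Rightarrow> ('v \<Rightarrow>\<^sub>0 nat) set" where
  "terms_in V = {t. keys t \<subseteq> V}"

lemma keys_add_nat: "keys (s + t) = keys s \<union> keys (t :: 'v \<Rightarrow>\<^sub>0 nat)"
  by (auto simp: in_keys_iff lookup_add)

text \<open>
  Keeping the monomials in the indeterminates \<open>V\<close> is the evaluation at 0 of all others.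
\<close>

lemma part_terms_in_times:
  fixes p q :: "('v \<Rightarrow>\<^sub>0 nat) \<Rightarrow>\<^sub>0 'b::comm_ring"
  shows "part (terms_in V) (p * q) = part (terms_in V) p * part (terms_in V) q"
  by (rule part_times) (auto simp: terms_in_def keys_add_nat)

lemma factor_of_term_in:
  fixes p q :: "('v::linorder \<Rightarrow>\<^sub>0 nat) \<Rightarrow>\<^sub>0 'b::idom"
  assumes "keys (p * q) \<inter> terms_in V = {u}"
  obtains s t where "keys p \<inter> terms_in V = {s}" "keys q \<inter> terms_in V = {t}" "s + t = u"
proof -
  have "keys (part (terms_in V) p * part (terms_in V) q) = {u}"
    using assms by (simp add: keys_part flip: part_terms_in_times)
  then show thesis using that by (elim factor_of_term) (simp add: keys_part)
qed


section \<open>The Leibniz expansion of the determinant\<close>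

text \<open>
  A nonzero product in the Leibniz formula assigns to each row \<open>b\<close>, injectively, a column
  \<open>(i, a)\<close> such that \<open>b - a\<close> is an exponent of \<open>F\<^sub>i\<close>. The set \<open>V\<close> prescribes the indeterminates that
  may occur as factors. Addition is used to express \<open>b - a\<close>, since subtraction of natural numbers
  truncates.
\<close>

definition arrangement :: "nat \<Rightarrow> nat \<Rightarrow> (nat \<times> (nat \<times> nat)) set
    \<Rightarrow> (nat \<times> nat \<Rightarrow> nat \<times> (nat \<times> nat)) \<Rightarrow> bool" where
  "arrangement m n V g \<longleftrightarrow>
    bij_betw g (exponents (2 * m - 1) (2 * n - 1)) ({1..4} \<times> exponents (m - 1) (n - 1)) \<and>
    (\<forall>b\<in>exponents (2 * m - 1) (2 * n - 1). \<exists>v\<in>V. fst (g b) = fst v \<and> b = snd (g b) + snd v)"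

definition arrangement_var :: "(nat \<times> nat \<Rightarrow> nat \<times> (nat \<times> nat)) \<Rightarrow> nat \<times> nat \<Rightarrow> nat \<times> (nat \<times> nat)" where
  "arrangement_var g b = (fst (g b), b - snd (g b))"

definition arrangement_term :: "nat \<Rightarrow> nat \<Rightarrow> (nat \<times> nat \<Rightarrow> nat \<times> (nat \<times> nat))
    \<Rightarrow> (nat \<times> (nat \<times> nat)) \<Rightarrow>\<^sub>0 nat" where
  "arrangement_term m n g = (\<Sum>b\<in>exponents (2 * m - 1) (2 * n - 1). single (arrangement_var g b) 1)"

lemma finite_exponents [simp]: "finite (exponents i j)"
  by (simp add: exponents_def)

lemma arrangement_var_eq:
  assumes "fst (g b) = fst v" "b = snd (g b) + snd v"
  shows "arrangement_var g b = v"
  using assms(1) arg_cong[OF assms(2), of "\<lambda>x. x - snd (g b)"]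
  by (simp add: arrangement_var_def prod_eq_iff)

lemma keys_arrangement_term:
  "keys (arrangement_term m n g) = arrangement_var g ` exponents (2 * m - 1) (2 * n - 1)"
proof -
  have "keys (\<Sum>b\<in>B. single (f b) (1::nat)) = f ` B" if "finite B" for B :: "'a set" and f :: "'a \<Rightarrow> 'b"
    using that by (induction B rule: finite_induct) (auto simp: keys_add_nat)
  from this[OF finite_exponents] show ?thesis unfolding arrangement_term_def .
qed

lemma arrangement_keys:
  assumes "arrangement m n V g"
  shows "keys (arrangement_term m n g) \<subseteq> V"
  using assms arrangement_var_eq unfolding keys_arrangement_term arrangement_def by fastforce

text \<open>
  The monomial of an arrangement determines which indeterminates it uses.
\<close>

lemma arrangement_restrict:
  assumes "arrangement m n V g" "keys (arrangement_term m n g) \<subseteq> W"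
  shows "arrangement m n W g"
  unfolding arrangement_def
proof (intro conjI ballI)
  fix b assume b: "b \<in> exponents (2 * m - 1) (2 * n - 1)"
  then obtain v where v: "v \<in> V" "fst (g b) = fst v" "b = snd (g b) + snd v"
    using assms(1) unfolding arrangement_def by blast
  have "v \<in> W"
    using arrangement_var_eq[of g b v, OF v(2,3)] b assms(2) unfolding keys_arrangement_term by blast
  then show "\<exists>v\<in>W. fst (g b) = fst v \<and> b = snd (g b) + snd v" using v by blast
qed (use assms in \<open>simp add: arrangement_def\<close>)

lemma arrangement_cong:
  assumes "\<And>b. b \<in> exponents (2 * m - 1) (2 * n - 1) \<Longrightarrow> g' b = g b" "arrangement m n V g"
  shows "arrangement m n V g'"
  unfolding arrangement_def
proof (intro conjI ballI)
  show "bij_betw g' (exponents (2 * m - 1) (2 * n - 1)) ({1..4} \<times> exponents (m - 1) (n - 1))"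
    using assms(2) bij_betw_cong[of "exponents (2 * m - 1) (2 * n - 1)" g' g] assms(1)
    unfolding arrangement_def by simp
next
  fix b assume b: "b \<in> exponents (2 * m - 1) (2 * n - 1)"
  then show "\<exists>v\<in>V. fst (g' b) = fst v \<and> b = snd (g' b) + snd v"
    using assms(2) unfolding arrangement_def assms(1)[OF b] by blast
qed

lemma prod_single:
  "finite I \<Longrightarrow> (\<Prod>i\<in>I. single (f i) 1) = single (\<Sum>i\<in>I. f i) (1 :: 'b::comm_semiring_1)"
  by (induction I rule: finite_induct) (auto simp: mult_single)

lemma lookup_sign_times:
  fixes x :: "'t::monoid_add \<Rightarrow>\<^sub>0 int"
  shows "lookup (of_int (sign p) * x) t = sign p * lookup x t"
  by (cases p rule: sign_cases) auto

text \<open>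
  The map from rows to columns that a permutation of positions induces, given the two listings of the
  bases.
\<close>

definition perm_map :: "'a list \<Rightarrow> 'b list \<Rightarrow> (nat \<Rightarrow> nat) \<Rightarrow> 'a \<Rightarrow> 'b" where
  "perm_map rs cs p b = cs ! p (inv_into {..<length rs} ((!) rs) b)"

lemma bij_betw_enumeration:
  "is_enumeration xs X \<Longrightarrow> bij_betw ((!) xs) {..<length xs} X"
  unfolding is_enumeration_def by (intro bij_betw_nth) auto

lemma perm_map_nth:
  assumes "is_enumeration rs R" "i < length rs"
  shows "perm_map rs cs p (rs ! i) = cs ! p i"
  using assms bij_betw_inv_into_left[OF bij_betw_enumeration, of rs R i] by (simp add: perm_map_def)

lemma bij_betw_perm_map:
  assumes "is_enumeration rs R" "is_enumeration cs C" "length cs = length rs"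
    and "p permutes {..<length rs}"
  shows "bij_betw (perm_map rs cs p) R C"
proof -
  have "bij_betw (((!) cs \<circ> p) \<circ> inv_into {..<length rs} ((!) rs)) R C"
    using assms(3)
    by (intro bij_betw_trans[OF bij_betw_inv_into[OF bij_betw_enumeration[OF assms(1)]]]
        bij_betw_trans[OF permutes_imp_bij[OF assms(4)]])
      (use bij_betw_enumeration[OF assms(2)] in simp)
  then show ?thesis by (simp add: perm_map_def[abs_def] comp_def)
qed

lemma perm_map_inject:
  assumes "is_enumeration rs R" "is_enumeration cs C" "length cs = length rs"
    and p: "p permutes {..<length rs}" and q: "q permutes {..<length rs}"
    and eq: "\<And>b. b \<in> R \<Longrightarrow> perm_map rs cs p b = perm_map rs cs q b"
  shows "p = q"
proof
  fix i
  show "p i = q i"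
  proof (cases "i < length rs")
    case True
    then have "cs ! p i = cs ! q i"
      using eq[of "rs ! i"] assms(1) perm_map_nth[OF assms(1) True, of cs]
      by (auto simp: is_enumeration_def)
    moreover have "p i < length cs" "q i < length cs"
      using True permutes_in_image[OF p] permutes_in_image[OF q] assms(3) by auto
    ultimately show ?thesis using assms(2) nth_eq_iff_index_eq by (auto simp: is_enumeration_def)
  next
    case False
    then show ?thesis using p q by (simp add: permutes_def)
  qed
qed

lemma perm_map_surj:
  assumes "is_enumeration rs R" "is_enumeration cs C" "length cs = length rs"
    and g: "bij_betw g R C"
  obtains p where "p permutes {..<length rs}" "\<And>b. b \<in> R \<Longrightarrow> perm_map rs cs p b = g b"
proof -
  define f where "f = (inv_into {..<length cs} ((!) cs) \<circ> g) \<circ> (!) rs"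
  define p where "p i = (if i < length rs then f i else i)" for i
  have "bij_betw f {..<length rs} {..<length rs}"
    unfolding f_def
    using bij_betw_trans[OF bij_betw_enumeration[OF assms(1)]
        bij_betw_trans[OF g bij_betw_inv_into[OF bij_betw_enumeration[OF assms(2)]]]] assms(3)
    by (simp add: comp_assoc)
  then have "bij_betw p {..<length rs} {..<length rs}"
    by (rule bij_betw_cong[THEN iffD1, rotated]) (simp add: p_def)
  then have "p permutes {..<length rs}"
    by (rule bij_imp_permutes) (simp add: p_def)
  moreover have "perm_map rs cs p b = g b" if b: "b \<in> R" for b
  proof -
    obtain i where i: "i < length rs" "b = rs ! i"
      using b assms(1) by (metis in_set_conv_nth is_enumeration_def)
    have "g b \<in> C" using g b by (auto simp: bij_betw_def)
    then show ?thesis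
      using bij_betw_inv_into_right[OF bij_betw_enumeration[OF assms(2)]] i
      by (simp add: perm_map_nth[OF assms(1)] p_def f_def)
  qed
  ultimately show thesis using that by blast
qed

lemma det_as_arrangement_sum:
  assumes "0 < m" and "0 < n"
    and rs: "is_enumeration rs (exponents (2 * m - 1) (2 * n - 1))"
    and cs: "is_enumeration cs ({1..4} \<times> exponents (m - 1) (n - 1))"
  shows "Determinant.det (syl_mat (generic_poly m n) rs cs)
    = (\<Sum>p | p permutes {..<length rs}. of_int (sign p) *
        (if arrangement m n ({1..4} \<times> exponents m n) (perm_map rs cs p)
         then single (arrangement_term m n (perm_map rs cs p)) 1 else 0))"
proof -
  let ?R = "exponents (2 * m - 1) (2 * n - 1)" and ?C = "{1..4::nat} \<times> exponents (m - 1) (n - 1)"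
  let ?A = "syl_mat (generic_poly m n) rs cs"
  define ok where "ok g b \<longleftrightarrow> (\<exists>v\<in>{1..4} \<times> exponents m n. fst (g b) = fst v \<and> b = snd (g b) + snd v)"
    for g :: "nat \<times> nat \<Rightarrow> nat \<times> (nat \<times> nat)" and b
  have len: "length cs = length rs"
    using length_bases[OF assms(1,2)] rs cs by simp
  have prod: "(\<Prod>i = 0..<length rs. ?A $$ (i, p i))
      = (if arrangement m n ({1..4} \<times> exponents m n) (perm_map rs cs p)
         then single (arrangement_term m n (perm_map rs cs p)) 1 else 0)"
    if p: "p permutes {..<length rs}" for p
  proof -
    let ?g = "perm_map rs cs p"
    have gC: "?g b \<in> ?C" if "b \<in> ?R" for b
      using bij_betw_perm_map[OF rs cs len p] that by (auto simp: bij_betw_def)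
    have entry: "?A $$ (i, p i)
        = (if ok ?g (rs ! i) then single (single (arrangement_var ?g (rs ! i)) 1) 1 else 0)"
      if i: "i < length rs" for i
    proof -
      obtain k a where ka: "cs ! p i = (k, a)" by (rule prod.exhaust)
      have g: "?g (rs ! i) = (k, a)" by (rule trans[OF perm_map_nth[OF rs i, of cs p] ka])
      have b: "rs ! i \<in> ?R" using bij_betwE[OF bij_betw_enumeration[OF rs]] i by blast
      have k: "k \<in> {1..4}" using gC[OF b] g by simp
      have pi: "p i < length cs" using permutes_in_image[OF p, of i] i len by simp
      have "ok ?g (rs ! i) \<longleftrightarrow> fst a \<le> fst (rs ! i) \<and> snd a \<le> snd (rs ! i) \<and> rs ! i - a \<in> exponents m n"
      proof
        assume "ok ?g (rs ! i)"
        then obtain e where "e \<in> exponents m n" "rs ! i = a + e" unfolding ok_def g by auto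
        then show "fst a \<le> fst (rs ! i) \<and> snd a \<le> snd (rs ! i) \<and> rs ! i - a \<in> exponents m n" by simp
      next
        assume "fst a \<le> fst (rs ! i) \<and> snd a \<le> snd (rs ! i) \<and> rs ! i - a \<in> exponents m n"
        then show "ok ?g (rs ! i)" unfolding ok_def g
          by (intro bexI[of _ "(k, rs ! i - a)"]) (use k in \<open>auto simp: prod_eq_iff\<close>)
      qed
      then show ?thesis
        using syl_mat_entry[OF i pi ka k, where u = indet and m = m and n = n] g
        unfolding generic_poly_def[abs_def] by (simp add: indet_def arrangement_var_def)
    qed
    have "(\<Prod>i = 0..<length rs. ?A $$ (i, p i))
        = (\<Prod>i<length rs. if ok ?g (rs ! i) then single (single (arrangement_var ?g (rs ! i)) 1) 1 else 0)"
      by (simp add: entry atLeast0LessThan)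
    also have "\<dots> = (\<Prod>b\<in>?R. if ok ?g b then single (single (arrangement_var ?g b) 1) 1 else 0)"
      by (rule prod.reindex_bij_betw[OF bij_betw_enumeration[OF rs]])
    also have "\<dots> = (if \<forall>b\<in>?R. ok ?g b then single (arrangement_term m n ?g) 1 else 0)"
    proof (cases "\<forall>b\<in>?R. ok ?g b")
      case True
      then show ?thesis by (simp add: prod_single arrangement_term_def)
    qed auto
    also have "(\<forall>b\<in>?R. ok ?g b) \<longleftrightarrow> arrangement m n ({1..4} \<times> exponents m n) ?g"
      using bij_betw_perm_map[OF rs cs len p] by (simp add: arrangement_def ok_def)
    finally show ?thesis .
  qed
  have A: "?A \<in> carrier_mat (length rs) (length rs)" by (simp add: syl_mat_def len)
  show ?thesis
    unfolding det_def'[OF A] atLeast0LessThan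
    by (intro sum.cong refl) (simp add: prod[unfolded atLeast0LessThan])
qed

lemma lookup_det:
  assumes "0 < m" and "0 < n"
    and rs: "is_enumeration rs (exponents (2 * m - 1) (2 * n - 1))"
    and cs: "is_enumeration cs ({1..4} \<times> exponents (m - 1) (n - 1))"
  shows "lookup (Determinant.det (syl_mat (generic_poly m n) rs cs)) t
    = (\<Sum>p | p permutes {..<length rs} \<and> arrangement m n ({1..4} \<times> exponents m n) (perm_map rs cs p) \<and>
        arrangement_term m n (perm_map rs cs p) = t. sign p)"
proof -
  have "lookup (Determinant.det (syl_mat (generic_poly m n) rs cs)) t
      = (\<Sum>p | p permutes {..<length rs}.
          if arrangement m n ({1..4} \<times> exponents m n) (perm_map rs cs p) \<and>
            arrangement_term m n (perm_map rs cs p) = t then sign p else 0)"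
    unfolding det_as_arrangement_sum[OF assms] lookup_sum lookup_sign_times
    by (intro sum.cong) (auto simp: lookup_single when_def)
  then show ?thesis
    by (simp add: sum.inter_filter[symmetric] finite_permutations)
qed

lemma det_term_arrangement:
  assumes "0 < m" and "0 < n"
    and "is_enumeration rs (exponents (2 * m - 1) (2 * n - 1))"
    and "is_enumeration cs ({1..4} \<times> exponents (m - 1) (n - 1))"
    and "t \<in> keys (Determinant.det (syl_mat (generic_poly m n) rs cs))"
  obtains g where "arrangement m n ({1..4} \<times> exponents m n) g" "arrangement_term m n g = t"
proof -
  have "lookup (Determinant.det (syl_mat (generic_poly m n) rs cs)) t \<noteq> 0"
    using assms(5) by (simp add: in_keys_iff)
  then have "{p. p permutes {..<length rs} \<and> arrangement m n ({1..4} \<times> exponents m n) (perm_map rs cs p) \<and>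
      arrangement_term m n (perm_map rs cs p) = t} \<noteq> {}"
    unfolding lookup_det[OF assms(1-4)] by (metis sum.empty)
  then show thesis using that by blast
qed

text \<open>
  Distinct arrangements may share a monomial and cancel. If only one arrangement uses no indeterminates
  outside \<open>V\<close>, cancellation is impossible, and setting the other indeterminates to 0 leaves
  its monomial with sign.
\<close>

lemma det_unique_arrangement:
  assumes "0 < m" and "0 < n"
    and rs: "is_enumeration rs (exponents (2 * m - 1) (2 * n - 1))"
    and cs: "is_enumeration cs ({1..4} \<times> exponents (m - 1) (n - 1))"
    and V: "V \<subseteq> {1..4} \<times> exponents m n" and g: "arrangement m n V g"
    and uniq: "\<And>g' b. arrangement m n V g' \<Longrightarrow> b \<in> exponents (2 * m - 1) (2 * n - 1) \<Longrightarrow> g' b = g b"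
  shows "keys (Determinant.det (syl_mat (generic_poly m n) rs cs)) \<inter> terms_in V
      = {arrangement_term m n g}"
    and "lookup (Determinant.det (syl_mat (generic_poly m n) rs cs)) (arrangement_term m n g) \<in> {1, -1}"
proof -
  let ?D = "Determinant.det (syl_mat (generic_poly m n) rs cs)" and ?t = "arrangement_term m n g"
  let ?full = "{1..4} \<times> exponents m n"
  have len: "length cs = length rs"
    using length_bases[OF assms(1,2)] rs cs by simp
  have same_term: "arrangement_term m n g' = ?t"
    if "\<And>b. b \<in> exponents (2 * m - 1) (2 * n - 1) \<Longrightarrow> g' b = g b" for g'
    using that by (simp add: arrangement_term_def arrangement_var_def)
  obtain p where p: "p permutes {..<length rs}"
      "\<And>b. b \<in> exponents (2 * m - 1) (2 * n - 1) \<Longrightarrow> perm_map rs cs p b = g b"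
    by (rule perm_map_surj[OF rs cs len, of g]) (use g in \<open>simp_all add: arrangement_def\<close>)
  have arr: "arrangement m n ?full (perm_map rs cs p)"
  proof (rule arrangement_cong[of m n "perm_map rs cs p" g])
    show "arrangement m n ?full g"
      by (rule arrangement_restrict[OF g]) (rule subset_trans[OF arrangement_keys[OF g] V])
  qed (rule p(2))
  have "{q. q permutes {..<length rs} \<and> arrangement m n ?full (perm_map rs cs q) \<and>
      arrangement_term m n (perm_map rs cs q) = ?t} = {p}" (is "?P = _")
  proof (intro equalityI subsetI)
    fix q assume "q \<in> ?P"
    then have q: "q permutes {..<length rs}" "arrangement m n ?full (perm_map rs cs q)"
      "arrangement_term m n (perm_map rs cs q) = ?t" by auto
    have V: "arrangement m n V (perm_map rs cs q)"
      by (rule arrangement_restrict[OF q(2)]) (use arrangement_keys[OF g] q(3) in simp)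
    have "q = p"
    proof (rule perm_map_inject[OF rs cs len q(1) p(1)])
      fix b assume b: "b \<in> exponents (2 * m - 1) (2 * n - 1)"
      show "perm_map rs cs q b = perm_map rs cs p b"
        using uniq[OF V b] p(2)[OF b] by (rule trans[OF _ sym])
    qed
    then show "q \<in> {p}" by simp
  next
    fix q assume "q \<in> {p}"
    then have q: "q = p" by simp
    have "arrangement_term m n (perm_map rs cs p) = ?t" by (rule same_term) (rule p(2))
    then show "q \<in> ?P" using p(1) arr unfolding q by blast
  qed
  then have coeff: "lookup ?D ?t = sign p"
    unfolding lookup_det[OF assms(1-4)] by simp
  then show "lookup ?D ?t \<in> {1, -1}" by (cases p rule: sign_cases) auto
  then have tD: "?t \<in> keys ?D" by (auto simp: in_keys_iff)
  have tV: "?t \<in> terms_in V" using arrangement_keys[OF g] by (simp add: terms_in_def)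
  have only: "t = ?t" if t: "t \<in> keys ?D" "t \<in> terms_in V" for t
  proof -
    obtain g' where g': "arrangement m n ?full g'" "arrangement_term m n g' = t"
      by (rule det_term_arrangement[OF assms(1-4) t(1)])
    have V: "arrangement m n V g'"
      by (rule arrangement_restrict[OF g'(1)]) (use t(2) g'(2) in \<open>simp add: terms_in_def\<close>)
    have "arrangement_term m n g' = ?t" by (rule same_term) (rule uniq[OF V])
    then show ?thesis using g'(2) by simp
  qed
  show "keys ?D \<inter> terms_in V = {?t}"
    using only tD tV by blast
qed

text \<open>
  If the weight of the matrix entry in row \<open>b\<close> and column \<open>c\<close> splits as \<open>\<alpha> b + \<beta> c\<close>, then all
  arrangements have the same weight, because each uses every row and every column once. The
  degrees in the coefficients of a single \<open>F\<^sub>i\<close> and the \<open>x\<close>- and \<open>y\<close>-degrees are of this kind.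
\<close>

lemma arrangement_weight:
  assumes g: "arrangement m n V g"
    and f: "\<And>i a e. f (i, e) = \<alpha> (a + e) + \<beta> (i, a)"
  shows "weight f (arrangement_term m n g)
    = (\<Sum>b\<in>exponents (2 * m - 1) (2 * n - 1). \<alpha> b) + (\<Sum>c\<in>{1..4} \<times> exponents (m - 1) (n - 1). \<beta> c)"
proof -
  let ?R = "exponents (2 * m - 1) (2 * n - 1)"
  have "weight f (arrangement_term m n g) = (\<Sum>b\<in>?R. f (arrangement_var g b))"
    by (simp add: arrangement_term_def weight_sum weight_single)
  also have "\<dots> = (\<Sum>b\<in>?R. \<alpha> b + \<beta> (g b))"
  proof (rule sum.cong)
    fix b assume "b \<in> ?R"
    then obtain v where v: "fst (g b) = fst v" "b = snd (g b) + snd v"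
      using g unfolding arrangement_def by blast
    then have "f (arrangement_var g b) = f (fst (g b), snd v)"
      by (simp add: arrangement_var_eq[of g b v, OF v])
    also have "\<dots> = \<alpha> b + \<beta> (g b)"
      using f[of "fst (g b)" "snd v" "snd (g b)"] v(2) by simp
    finally show "f (arrangement_var g b) = \<alpha> b + \<beta> (g b)" .
  qed simp
  also have "\<dots> = (\<Sum>b\<in>?R. \<alpha> b) + (\<Sum>b\<in>?R. \<beta> (g b))" by (rule sum.distrib)
  also have "(\<Sum>b\<in>?R. \<beta> (g b)) = (\<Sum>c\<in>{1..4} \<times> exponents (m - 1) (n - 1). \<beta> c)"
    using g unfolding arrangement_def by (intro sum.reindex_bij_betw) auto
  finally show ?thesis .
qed


section \<open>Arrangements for the sparse specializations\<close>

lemma arrangement_choice: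
  assumes "arrangement m n V g" "b \<in> exponents (2 * m - 1) (2 * n - 1)"
  shows "\<exists>i s j e. g b = (i, (s, j)) \<and> (i, e) \<in> V \<and> b = (s + fst e, j + snd e) \<and>
    s \<le> m - 1 \<and> j \<le> n - 1"
proof -
  obtain v where v: "v \<in> V" "fst (g b) = fst v" "b = snd (g b) + snd v"
    using assms unfolding arrangement_def by blast
  have C: "g b \<in> {1..4} \<times> exponents (m - 1) (n - 1)"
    using assms unfolding arrangement_def bij_betw_def by blast
  show ?thesis
    by (rule exI[of _ "fst (g b)"], rule exI[of _ "fst (snd (g b))"],
        rule exI[of _ "snd (snd (g b))"], rule exI[of _ "snd v"])
      (use v C in \<open>auto simp: exponents_def mem_Times_iff prod_eq_iff\<close>)
qed

lemma arrangement_column: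
  assumes "arrangement m n V g" "i \<in> {1..4}" "s < m" "j < n"
  shows "\<exists>e. (i, e) \<in> V \<and> (s + fst e, j + snd e) \<in> exponents (2 * m - 1) (2 * n - 1) \<and>
    g (s + fst e, j + snd e) = (i, (s, j))"
proof -
  have "(i, (s, j)) \<in> {1..4} \<times> exponents (m - 1) (n - 1)"
    using assms(2-4) by (auto simp: exponents_def)
  then have "(i, (s, j)) \<in> g ` exponents (2 * m - 1) (2 * n - 1)"
    using assms(1) unfolding arrangement_def bij_betw_def by blast
  then obtain b where b: "b \<in> exponents (2 * m - 1) (2 * n - 1)" "g b = (i, (s, j))"
    by (auto elim!: imageE)
  obtain i' s' j' e where "g b = (i', (s', j'))" "(i', e) \<in> V" "b = (s' + fst e, j' + snd e)"
    using arrangement_choice[OF assms(1) b(1)] by blast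
  then show ?thesis using b by (intro exI[of _ e]) simp
qed

lemma arrangement_inj:
  assumes "arrangement m n V g" "b \<in> exponents (2 * m - 1) (2 * n - 1)"
    "b' \<in> exponents (2 * m - 1) (2 * n - 1)" "g b = g b'"
  shows "b = b'"
  using assms unfolding arrangement_def bij_betw_def inj_on_def by blast

text \<open>
  The map \<open>h\<close> from columns to rows is the inverse of \<open>g\<close>.
\<close>

lemma arrangement_byWitness:
  assumes V: "\<And>x y. x < 2 * m \<Longrightarrow> y < 2 * n \<Longrightarrow>
      \<exists>i s j. g (x, y) = (i, (s, j)) \<and> (i, (x - s, y - j)) \<in> V \<and> i \<in> {1..4} \<and> s < m \<and> j < n \<and>
        s \<le> x \<and> j \<le> y \<and> h (i, (s, j)) = (x, y)"
    and h: "\<And>i s j. i \<in> {1..4} \<Longrightarrow> s < m \<Longrightarrow> j < n \<Longrightarrow>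
      \<exists>x y. h (i, (s, j)) = (x, y) \<and> x < 2 * m \<and> y < 2 * n \<and> g (x, y) = (i, (s, j))"
    and "0 < m" "0 < n"
  shows "arrangement m n V g"
proof -
  have R: "b \<in> exponents (2 * m - 1) (2 * n - 1) \<longleftrightarrow> fst b < 2 * m \<and> snd b < 2 * n" for b
    using assms(3,4) by (auto simp: exponents_def mem_Times_iff)
  have C: "c \<in> {1..4} \<times> exponents (m - 1) (n - 1)
      \<longleftrightarrow> fst c \<in> {1..4} \<and> fst (snd c) < m \<and> snd (snd c) < n" for c :: "nat \<times> (nat \<times> nat)"
    using assms(3,4) by (auto simp: exponents_def mem_Times_iff)
  have *: "(\<exists>v\<in>V. fst (g b) = fst v \<and> b = snd (g b) + snd v) \<and> h (g b) = b \<and>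
      g b \<in> {1..4} \<times> exponents (m - 1) (n - 1)"
    if b: "b \<in> exponents (2 * m - 1) (2 * n - 1)" for b
  proof -
    obtain i s j where e: "g b = (i, (s, j))" "(i, (fst b - s, snd b - j)) \<in> V" "i \<in> {1..4}"
        "s < m" "j < n" "s \<le> fst b" "j \<le> snd b" "h (i, (s, j)) = b"
      using V[of "fst b" "snd b"] b unfolding R prod.collapse by blast
    then show ?thesis unfolding C
      by (auto simp: prod_eq_iff intro!: bexI[of _ "(i, (fst b - s, snd b - j))"])
  qed
  have **: "h c \<in> exponents (2 * m - 1) (2 * n - 1) \<and> g (h c) = c"
    if c: "c \<in> {1..4} \<times> exponents (m - 1) (n - 1)" for c
    using h[of "fst c" "fst (snd c)" "snd (snd c)"] c unfolding R C prod.collapse by auto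
  have "bij_betw g (exponents (2 * m - 1) (2 * n - 1)) ({1..4} \<times> exponents (m - 1) (n - 1))"
    by (rule bij_betw_byWitness[where f' = h]) (use * ** in blast)+
  then show ?thesis unfolding arrangement_def using * by blast
qed

text \<open>
  The arrangement for four monomials at the corners: the row decides, by its quadrant in the
  \<open>2 m\<close> by \<open>2 n\<close> rectangle, which corner has to be subtracted. The first index of \<open>i00, i10, i01, i11\<close>
  refers to \<open>x\<close>, the second to \<open>y\<close>.
\<close>

definition corner_arrangement :: "nat \<Rightarrow> nat \<Rightarrow> nat \<Rightarrow> nat \<Rightarrow> nat \<Rightarrow> nat \<Rightarrow> nat \<times> nat \<Rightarrow> nat \<times> (nat \<times> nat)" where
  "corner_arrangement m n i00 i10 i01 i11 = (\<lambda>(x, y).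
    if x < m then if y < n then (i00, (x, y)) else (i01, (x, y - n))
    else if y < n then (i10, (x - m, y)) else (i11, (x - m, y - n)))"

lemma arrangement_corner:
  assumes "0 < m" "0 < n"
    and i: "{i00, i10, i01, i11} = {1..4}" "distinct [i00, i10, i01, i11]"
  shows "arrangement m n {(i00, (0, 0)), (i10, (m, 0)), (i01, (0, n)), (i11, (m, n))}
    (corner_arrangement m n i00 i10 i01 i11)"
proof (rule arrangement_byWitness[where h = "\<lambda>(i, (s, j)).
    (s + (if i = i10 \<or> i = i11 then m else 0), j + (if i = i01 \<or> i = i11 then n else 0))"])
  have r: "i00 \<in> {1..4}" "i10 \<in> {1..4}" "i01 \<in> {1..4}" "i11 \<in> {1..4}"
    unfolding i(1)[symmetric] by simp_all
  fix x y assume "x < 2 * m" "y < 2 * n"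
  then show "\<exists>i s j. corner_arrangement m n i00 i10 i01 i11 (x, y) = (i, (s, j)) \<and>
      (i, (x - s, y - j)) \<in> {(i00, (0, 0)), (i10, (m, 0)), (i01, (0, n)), (i11, (m, n))} \<and>
      i \<in> {1..4} \<and> s < m \<and> j < n \<and> s \<le> x \<and> j \<le> y \<and>
      (case (i, (s, j)) of (i, (s, j)) \<Rightarrow>
        (s + (if i = i10 \<or> i = i11 then m else 0), j + (if i = i01 \<or> i = i11 then n else 0))) = (x, y)"
    using r i(2) by (cases "x < m"; cases "y < n") (force simp: corner_arrangement_def)+
next
  fix i s j assume *: "i \<in> {1..4::nat}" "s < m" "j < n"
  have "i \<in> {i00, i10, i01, i11}" using *(1) unfolding i(1) .
  then show "\<exists>x y. (case (i, (s, j)) of (i, (s, j)) \<Rightarrow>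
      (s + (if i = i10 \<or> i = i11 then m else 0), j + (if i = i01 \<or> i = i11 then n else 0))) = (x, y) \<and>
      x < 2 * m \<and> y < 2 * n \<and> corner_arrangement m n i00 i10 i01 i11 (x, y) = (i, (s, j))"
    using *(2,3) i(2) by (auto simp: corner_arrangement_def)
qed (use assms in auto)

lemma arrangement_corner_unique:
  assumes "arrangement m n {(i00, (0, 0)), (i10, (m, 0)), (i01, (0, n)), (i11, (m, n))} g"
    and "b \<in> exponents (2 * m - 1) (2 * n - 1)" "0 < m" "0 < n"
  shows "g b = corner_arrangement m n i00 i10 i01 i11 b"
proof -
  obtain i s j e where "g b = (i, (s, j))" "b = (s + fst e, j + snd e)" "s \<le> m - 1" "j \<le> n - 1"
    "(i, e) \<in> {(i00, (0, 0)), (i10, (m, 0)), (i01, (0, n)), (i11, (m, n))}"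
    using arrangement_choice[OF assms(1,2)] by blast
  then show ?thesis using assms(3,4) by (auto simp: corner_arrangement_def)
qed

text \<open>
  The indeterminates \<open>u1, u2, v2, w3, w4\<close> of the decisive specialization, in this order; the
  others are \<open>u0 = (1, (0, 0))\<close>, \<open>v0 = (2, (0, 0))\<close> and \<open>v1 = (2, (0, 1))\<close>.
\<close>

definition core_vars :: "nat \<Rightarrow> nat \<Rightarrow> (nat \<times> (nat \<times> nat)) set" where
  "core_vars m n = {(1, (0, n)), (1, (m, 0)), (2, (m, n)), (3, (1, 0)), (4, (1, n))}"

text \<open>
  The part common to all arrangements of the decisive specialization. Multiples of \<open>F\<^sub>3\<close> and \<open>F\<^sub>4\<close>
  fill the rows with \<open>1 \<le> x \<le> m\<close>, and only \<open>u2\<close> and \<open>v2\<close> reach the rows with \<open>x > m\<close>.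
\<close>

definition outer_arrangement :: "nat \<Rightarrow> nat \<Rightarrow> nat \<times> nat \<Rightarrow> nat \<times> (nat \<times> nat)" where
  "outer_arrangement m n = (\<lambda>(x, y).
    if x \<le> m then if y < n then (3, (x - 1, y)) else (4, (x - 1, y - n))
    else if y < n then (1, (x - m, y)) else (2, (x - m, y - n)))"

text \<open>
  On the rows with \<open>x = 0\<close> there remains the Sylvester matrix of \<open>u0 + u1 y^n\<close> and \<open>v0 + v1 y\<close>,
  both taken as polynomials of degree \<open>n\<close>. Its determinant has two terms. This arrangement gives the
  one with \<open>u0 v1^n\<close>.
\<close>

definition first_arrangement :: "nat \<Rightarrow> nat \<Rightarrow> nat \<times> nat \<Rightarrow> nat \<times> (nat \<times> nat)" where
  "first_arrangement m n = (\<lambda>(x, y).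
    if x = 0 then if y = 0 then (1, (0, 0)) else if y \<le> n then (2, (0, y - 1)) else (1, (0, y - n))
    else outer_arrangement m n (x, y))"

text \<open>
  The term with \<open>u1 v0^n\<close>.
\<close>

definition second_arrangement :: "nat \<Rightarrow> nat \<Rightarrow> nat \<times> nat \<Rightarrow> nat \<times> (nat \<times> nat)" where
  "second_arrangement m n = (\<lambda>(x, y).
    if x = 0 then if y < n then (2, (0, y)) else (1, (0, y - n)) else outer_arrangement m n (x, y))"

lemma arrangement_first:
  assumes "0 < m" "0 < n"
  shows "arrangement m n (insert (1, (0, 0)) (insert (2, (0, 1)) (core_vars m n))) (first_arrangement m n)"
proof (rule arrangement_byWitness[where h = "\<lambda>(i, (s, j)).
    if i = 3 then (s + 1, j) else if i = 4 then (s + 1, j + n)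
    else if s = 0 then if i = 1 then (0, if j = 0 then 0 else j + n) else (0, j + 1)
    else if i = 1 then (s + m, j) else (s + m, j + n)"])
  fix x y assume "x < 2 * m" "y < 2 * n"
  then show "\<exists>i s j. first_arrangement m n (x, y) = (i, (s, j)) \<and>
      (i, (x - s, y - j)) \<in> insert (1, (0, 0)) (insert (2, (0, 1)) (core_vars m n)) \<and>
      i \<in> {1..4} \<and> s < m \<and> j < n \<and> s \<le> x \<and> j \<le> y \<and>
      (case (i, (s, j)) of (i, (s, j)) \<Rightarrow>
        if i = 3 then (s + 1, j) else if i = 4 then (s + 1, j + n)
        else if s = 0 then if i = 1 then (0, if j = 0 then 0 else j + n) else (0, j + 1)
        else if i = 1 then (s + m, j) else (s + m, j + n)) = (x, y)"
    using assms
    by (cases "x = 0"; cases "y = 0"; cases "y \<le> n"; cases "x \<le> m"; cases "y < n")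
      (auto simp: first_arrangement_def outer_arrangement_def core_vars_def)
next
  fix i s j assume "i \<in> {1..4::nat}" "s < m" "j < n"
  moreover from this have "i = 1 \<or> i = 2 \<or> i = 3 \<or> i = 4" by auto
  ultimately show "\<exists>x y. (case (i, (s, j)) of (i, (s, j)) \<Rightarrow>
        if i = 3 then (s + 1, j) else if i = 4 then (s + 1, j + n)
        else if s = 0 then if i = 1 then (0, if j = 0 then 0 else j + n) else (0, j + 1)
        else if i = 1 then (s + m, j) else (s + m, j + n)) = (x, y) \<and>
      x < 2 * m \<and> y < 2 * n \<and> first_arrangement m n (x, y) = (i, (s, j))"
    by (auto simp: first_arrangement_def outer_arrangement_def)
qed (use assms in auto)

lemma arrangement_second:
  assumes "0 < m" "0 < n"
  shows "arrangement m n (insert (2, (0, 0)) (core_vars m n)) (second_arrangement m n)"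
proof (rule arrangement_byWitness[where h = "\<lambda>(i, (s, j)).
    if i = 3 then (s + 1, j) else if i = 4 then (s + 1, j + n)
    else if s = 0 then if i = 1 then (0, j + n) else (0, j)
    else if i = 1 then (s + m, j) else (s + m, j + n)"])
  fix x y assume "x < 2 * m" "y < 2 * n"
  then show "\<exists>i s j. second_arrangement m n (x, y) = (i, (s, j)) \<and>
      (i, (x - s, y - j)) \<in> insert (2, (0, 0)) (core_vars m n) \<and>
      i \<in> {1..4} \<and> s < m \<and> j < n \<and> s \<le> x \<and> j \<le> y \<and>
      (case (i, (s, j)) of (i, (s, j)) \<Rightarrow>
        if i = 3 then (s + 1, j) else if i = 4 then (s + 1, j + n)
        else if s = 0 then if i = 1 then (0, j + n) else (0, j)
        else if i = 1 then (s + m, j) else (s + m, j + n)) = (x, y)"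
    using assms
    by (cases "x = 0"; cases "x \<le> m"; cases "y < n")
      (auto simp: second_arrangement_def outer_arrangement_def core_vars_def)
next
  fix i s j assume "i \<in> {1..4::nat}" "s < m" "j < n"
  moreover from this have "i = 1 \<or> i = 2 \<or> i = 3 \<or> i = 4" by auto
  ultimately show "\<exists>x y. (case (i, (s, j)) of (i, (s, j)) \<Rightarrow>
        if i = 3 then (s + 1, j) else if i = 4 then (s + 1, j + n)
        else if s = 0 then if i = 1 then (0, j + n) else (0, j)
        else if i = 1 then (s + m, j) else (s + m, j + n)) = (x, y) \<and>
      x < 2 * m \<and> y < 2 * n \<and> second_arrangement m n (x, y) = (i, (s, j))"
    by (auto simp: second_arrangement_def outer_arrangement_def)
qed (use assms in auto)

text \<open>
  A column of \<open>F\<^sub>3\<close> or \<open>F\<^sub>4\<close> has only one nonzero entry, which settles the rows with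
  \<open>1 \<le> x \<le> m\<close>. In a row with \<open>x > m\<close> any indeterminate other than \<open>u2\<close> and \<open>v2\<close> would require a
  column exponent beyond \<open>m - 1\<close>.
\<close>

lemma outer_arrangement_unique:
  assumes "0 < m" "0 < n"
    and V: "V \<subseteq> {(1, (0, 0)), (2, (0, 0)), (2, (0, 1))} \<union> core_vars m n"
    and g: "arrangement m n V g" and b: "(x, y) \<in> exponents (2 * m - 1) (2 * n - 1)" "0 < x"
  shows "g (x, y) = outer_arrangement m n (x, y)"
proof (cases "x \<le> m")
  case True
  define i j where "i = (if y < n then 3 else 4 :: nat)" and "j = (if y < n then y else y - n)"
  have "j < n" "i \<in> {1..4}" "x - 1 < m"
    using b True assms(1,2) by (auto simp: i_def j_def exponents_def)
  then obtain e where e: "(i, e) \<in> V" "g (x - 1 + fst e, j + snd e) = (i, (x - 1, j))"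
    using arrangement_column[OF g, of i "x - 1" j] by blast
  have "e = (1, if y < n then 0 else n)"
    using e(1) V by (auto simp: core_vars_def i_def)
  then show ?thesis
    using e(2) b True by (auto simp: outer_arrangement_def i_def j_def split: if_splits)
next
  case False
  obtain i s j e where "g (x, y) = (i, (s, j))" "(i, e) \<in> V" "(x, y) = (s + fst e, j + snd e)"
    "s \<le> m - 1" "j \<le> n - 1"
    using arrangement_choice[OF g b(1)] by blast
  moreover from this have "(i, e) \<in> {(1, (0, 0)), (2, (0, 0)), (2, (0, 1))} \<union> core_vars m n"
    using V by blast
  ultimately show ?thesis
    using False assms(1,2) by (auto simp: outer_arrangement_def core_vars_def)
qed

text \<open>
  With \<open>v0 = 0\<close> the column of \<open>F\<^sub>2\<close> with exponent \<open>(0, y - 1)\<close> reaches, outside the rows taken by \<open>F\<^sub>3\<close>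
  and \<open>F\<^sub>4\<close>, only the row \<open>(0, y)\<close>. The other rows with \<open>x = 0\<close> are left to \<open>F\<^sub>1\<close>, and each of them meets
  just one of its columns.
\<close>

lemma first_arrangement_unique:
  assumes "0 < m" "0 < n"
    and g: "arrangement m n (insert (1, (0, 0)) (insert (2, (0, 1)) (core_vars m n))) g"
    and b: "b \<in> exponents (2 * m - 1) (2 * n - 1)"
  shows "g b = first_arrangement m n b"
proof -
  obtain x y where xy: "b = (x, y)" by (rule prod.exhaust)
  have outer: "g (x', y') = outer_arrangement m n (x', y')"
    if "(x', y') \<in> exponents (2 * m - 1) (2 * n - 1)" "0 < x'" for x' y'
    by (rule outer_arrangement_unique[OF assms(1,2) _ g that]) auto
  consider "0 < x" | "x = 0" "0 < y" "y \<le> n" | "x = 0" "y = 0 \<or> n < y"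
    by (cases "x = 0"; cases "y = 0"; cases "y \<le> n") auto
  then show ?thesis
  proof cases
    case 1
    then show ?thesis using outer b by (simp add: first_arrangement_def xy)
  next
    case 2
    have "(2::nat) \<in> {1..4}" "y - 1 < n" using 2 assms(2) by auto
    then obtain e where e: "(2, e) \<in> insert (1, (0, 0)) (insert (2, (0, 1)) (core_vars m n))"
        "(0 + fst e, y - 1 + snd e) \<in> exponents (2 * m - 1) (2 * n - 1)"
        "g (0 + fst e, y - 1 + snd e) = (2, (0, y - 1))"
      using arrangement_column[OF g, of 2 0 "y - 1"] assms(1) by blast
    have "e = (0, 1) \<or> e = (m, n)" using e(1) by (auto simp: core_vars_def)
    \<comment> \<open>The row that \<open>v2\<close> would give, \<open>(m, y - 1 + n)\<close>, belongs to a column of \<open>F\<^sub>4\<close>.\<close>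
    moreover have "e \<noteq> (m, n)"
    proof
      assume "e = (m, n)"
      then have "outer_arrangement m n (m, y - 1 + n) = (2, (0, y - 1))"
        using outer[of m "y - 1 + n"] e(2,3) assms(1) by simp
      then show False by (simp add: outer_arrangement_def)
    qed
    ultimately show ?thesis using e(3) 2 by (simp add: first_arrangement_def xy)
  next
    case 3
    obtain i s j e where "g b = (i, (s, j))" "b = (s + fst e, j + snd e)" "s \<le> m - 1" "j \<le> n - 1"
      "(i, e) \<in> insert (1, (0, 0)) (insert (2, (0, 1)) (core_vars m n))"
      using arrangement_choice[OF g b] by blast
    then show ?thesis using 3 assms(1,2) by (auto simp: first_arrangement_def core_vars_def xy)
  qed
qed

text \<open>
  With \<open>u0 = 0\<close> the row \<open>(0, 0)\<close> is reached by \<open>v0\<close> only. Going up the rows \<open>(0, y)\<close>, the alternative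
  \<open>v1\<close> would need the column that the previous row already uses.
\<close>

lemma second_arrangement_unique:
  assumes "0 < m" "0 < n"
    and g: "arrangement m n (insert (2, (0, 0)) (insert (2, (0, 1)) (core_vars m n))) g"
    and b: "b \<in> exponents (2 * m - 1) (2 * n - 1)"
  shows "g b = second_arrangement m n b"
proof -
  obtain x y where xy: "b = (x, y)" by (rule prod.exhaust)
  have choice: "g (0, y) = second_arrangement m n (0, y) \<or> 0 < y \<and> y \<le> n \<and> g (0, y) = (2, (0, y - 1))"
    if y: "(0, y) \<in> exponents (2 * m - 1) (2 * n - 1)" for y
  proof -
    obtain i s j e where e: "g (0, y) = (i, (s, j))" "(0, y) = (s + fst e, j + snd e)" "j \<le> n - 1"
      "(i, e) \<in> insert (2, (0, 0)) (insert (2, (0, 1)) (core_vars m n))"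
      using arrangement_choice[OF g y] by blast
    have s: "s = 0" "fst e = 0" and y: "y = j + snd e" using e(2) by simp_all
    have "i = 1 \<and> snd e = n \<or> i = 2 \<and> (snd e = 0 \<or> snd e = 1)"
      using e(4) s(2) assms(1) by (auto simp: core_vars_def)
    then show ?thesis
      using e(1,3) assms(2) unfolding s y by (elim disjE conjE) (auto simp: second_arrangement_def)
  qed
  have column0: "g (0, y) = second_arrangement m n (0, y)"
    if "(0, y) \<in> exponents (2 * m - 1) (2 * n - 1)" for y
    using that
  proof (induction y)
    case 0
    then show ?case using choice[of 0] by simp
  next
    case (Suc y)
    have y: "(0, y) \<in> exponents (2 * m - 1) (2 * n - 1)" using Suc.prems by (auto simp: exponents_def)
    show ?case
    proof (rule ccontr)
      assume "g (0, Suc y) \<noteq> second_arrangement m n (0, Suc y)"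
      then have "Suc y \<le> n" "g (0, Suc y) = (2, (0, y))" using choice[OF Suc.prems] by auto
      moreover from this have "g (0, y) = (2, (0, y))"
        using Suc.IH[OF y] by (simp add: second_arrangement_def)
      ultimately have "(0, Suc y) = (0::nat, y)"
        by (intro arrangement_inj[OF g Suc.prems y]) simp
      then show False by simp
    qed
  qed
  show ?thesis
  proof (cases "x = 0")
    case True
    then show ?thesis using column0 b xy by simp
  next
    case False
    have "g (x, y) = outer_arrangement m n (x, y)"
      by (rule outer_arrangement_unique[OF assms(1,2) _ g]) (use b xy False in auto)
    then show ?thesis using False by (simp add: xy second_arrangement_def)
  qed
qed

lemma first_arrangement_once:
  assumes "0 < m" "0 < n"
  shows "lookup (arrangement_term m n (first_arrangement m n)) (1, (0, 0)) \<le> 1"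
proof -
  let ?R = "exponents (2 * m - 1) (2 * n - 1)"
  have "lookup (arrangement_term m n (first_arrangement m n)) (1, (0, 0))
      = (\<Sum>b\<in>?R. if arrangement_var (first_arrangement m n) b = (1, (0, 0)) then 1 else 0)"
    unfolding arrangement_term_def lookup_sum by (intro sum.cong) (auto simp: lookup_single when_def)
  also have "\<dots> \<le> (\<Sum>b\<in>?R. if b = (0, 0) then 1 else 0)"
  proof (rule sum_mono)
    fix b assume "b \<in> ?R"
    have "b = (0, 0)" if "arrangement_var (first_arrangement m n) b = (1, (0, 0))"
    proof -
      have "fst (first_arrangement m n b) = 1" "fst b - fst (snd (first_arrangement m n b)) = 0"
          "snd b - snd (snd (first_arrangement m n b)) = 0"
        using that by (simp_all add: arrangement_var_def prod_eq_iff)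
      then show ?thesis using assms
        by (cases b) (auto simp: first_arrangement_def outer_arrangement_def split: if_splits)
    qed
    then show "(if arrangement_var (first_arrangement m n) b = (1, (0, 0)) then 1 else 0::nat)
        \<le> (if b = (0, 0) then 1 else 0)" by simp
  qed
  also have "\<dots> \<le> 1" by simp
  finally show ?thesis .
qed


section \<open>Factors of the determinant\<close>

abbreviation (input) row_weight :: "nat \<Rightarrow> nat \<times> (nat \<times> nat) \<Rightarrow> int" where
  "row_weight i \<equiv> \<lambda>v. if fst v = i then 1 else 0"

abbreviation (input) x_weight :: "nat \<times> (nat \<times> nat) \<Rightarrow> int" where
  "x_weight \<equiv> \<lambda>v. int (fst (snd v))"

abbreviation (input) y_weight :: "nat \<times> (nat \<times> nat) \<Rightarrow> int" where
  "y_weight \<equiv> \<lambda>v. int (snd (snd v))"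

context
  fixes m n :: nat
    and rs :: "(nat \<times> nat) list"
    and cs :: "(nat \<times> (nat \<times> nat)) list"
    and D :: zpoly
  assumes m: "0 < m" and n: "0 < n"
    and rs: "is_enumeration rs (exponents (2 * m - 1) (2 * n - 1))"
    and cs: "is_enumeration cs ({1..4} \<times> exponents (m - 1) (n - 1))"
  defines "D \<equiv> Determinant.det (syl_mat (generic_poly m n) rs cs)"
begin

lemma det_first_term:
  "keys D \<inter> terms_in (insert (1, (0, 0)) (insert (2, (0, 1)) (core_vars m n)))
    = {arrangement_term m n (first_arrangement m n)}"
  "lookup D (arrangement_term m n (first_arrangement m n)) \<in> {1, -1}"
proof -
  let ?V = "insert (1, (0, 0)) (insert (2, (0, 1)) (core_vars m n))"
  have V: "?V \<subseteq> {1..4} \<times> exponents m n" using m n by (auto simp: core_vars_def exponents_def)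
  note * = det_unique_arrangement[OF m n rs cs V arrangement_first[OF m n], folded D_def]
  show "keys D \<inter> terms_in ?V = {arrangement_term m n (first_arrangement m n)}"
    by (rule *(1)) (rule first_arrangement_unique[OF m n])
  show "lookup D (arrangement_term m n (first_arrangement m n)) \<in> {1, -1}"
    by (rule *(2)) (rule first_arrangement_unique[OF m n])
qed

text \<open>
  The set admits \<open>v1\<close>, which is absent from the term, so that it contains every monomial of a factor that
  uses only \<open>v1\<close> and the core indeterminates.
\<close>

lemma det_second_term:
  "keys D \<inter> terms_in (insert (2, (0, 0)) (insert (2, (0, 1)) (core_vars m n)))
    = {arrangement_term m n (second_arrangement m n)}"
proof -
  let ?V = "insert (2, (0, 0)) (insert (2, (0, 1)) (core_vars m n))"
  have V: "?V \<subseteq> {1..4} \<times> exponents m n" using m n by (auto simp: core_vars_def exponents_def)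
  have g: "arrangement m n ?V (second_arrangement m n)"
    by (rule arrangement_restrict[OF arrangement_second[OF m n]])
      (use arrangement_keys[OF arrangement_second[OF m n]] in blast)
  show ?thesis
    unfolding D_def
    by (rule det_unique_arrangement(1)[OF m n rs cs V g]) (rule second_arrangement_unique[OF m n])
qed

lemma det_corner_term:
  assumes "{i00, i10, i01, i11} = {1..4}" "distinct [i00, i10, i01, i11]"
  shows "keys D \<inter> terms_in {(i00, (0, 0)), (i10, (m, 0)), (i01, (0, n)), (i11, (m, n))}
    = {arrangement_term m n (corner_arrangement m n i00 i10 i01 i11)}"
proof -
  have V: "{(i00, (0, 0)), (i10, (m, 0)), (i01, (0, n)), (i11, (m, n))} \<subseteq> {1..4} \<times> exponents m n"
    unfolding assms(1)[symmetric] by (auto simp: exponents_def)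
  show ?thesis
    unfolding D_def
    by (rule det_unique_arrangement(1)[OF m n rs cs V arrangement_corner[OF m n assms]])
      (rule arrangement_corner_unique[OF _ _ m n])
qed

lemma det_nonzero: "D \<noteq> 0"
  using det_first_term(1) by auto

text \<open>
  Splitting of the weight into row and column contributions makes the determinant homogeneous, hence
  every factor.
\<close>

lemma factor_weight_const:
  assumes PQ: "P * Q = D" and s: "s \<in> keys P" "s' \<in> keys P"
    and f: "\<And>i a e. f (i, e) = \<alpha> (a + e) + \<beta> (i, a)"
  shows "weight f s = weight f s'"
proof -
  have nz: "P \<noteq> 0" "Q \<noteq> 0" using det_nonzero PQ by auto
  then have "keys Q \<noteq> {}" by simp
  then obtain t where t: "t \<in> keys Q" by blast
  define d where "d = (\<Sum>b\<in>exponents (2 * m - 1) (2 * n - 1). \<alpha> b)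
    + (\<Sum>c\<in>{1..4} \<times> exponents (m - 1) (n - 1). \<beta> c)"
  have hom: "weight f u = d" if u: "u \<in> keys (P * Q)" for u
  proof -
    obtain g where g: "arrangement m n ({1..4} \<times> exponents m n) g" "arrangement_term m n g = u"
      using det_term_arrangement[OF m n rs cs] u unfolding PQ D_def by blast
    have "weight f (arrangement_term m n g) = d"
      unfolding d_def by (rule arrangement_weight[OF g(1)]) (rule f)
    then show ?thesis using g(2) by simp
  qed
  have "weight f s + weight f t = d" "weight f s' + weight f t = d"
    by (rule factor_homogeneous[of "weight f", OF weight_add nz hom]; use s t in simp)+
  then show ?thesis by simp
qed

lemma factor_row_degree_const:
  assumes "P * Q = D" "s \<in> keys P" "s' \<in> keys P"
  shows "weight (row_weight i) s = weight (row_weight i) s'"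
  by (rule factor_weight_const[OF assms, where \<alpha> = "\<lambda>b. 0" and \<beta> = "row_weight i"]) simp

lemma factor_x_degree_const:
  assumes "P * Q = D" "s \<in> keys P" "s' \<in> keys P"
  shows "weight x_weight s = weight x_weight s'"
  by (rule factor_weight_const[OF assms, where \<alpha> = "\<lambda>b. int (fst b)" and \<beta> = "\<lambda>c. - int (fst (snd c))"]) simp

lemma factor_y_degree_const:
  assumes "P * Q = D" "s \<in> keys P" "s' \<in> keys P"
  shows "weight y_weight s = weight y_weight s'"
  by (rule factor_weight_const[OF assms, where \<alpha> = "\<lambda>b. int (snd b)" and \<beta> = "\<lambda>c. - int (snd (snd c))"]) simp

text \<open>
  The specialization to corner monomials leaves \<open>P\<close> with a monomial in four indeterminates, one for
  each \<open>F\<^sub>i\<close>, whose exponents are therefore the degrees of \<open>P\<close> in the coefficients of the \<open>F\<^sub>i\<close>.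
\<close>

lemma factor_corner_degrees:
  assumes PQ: "P * Q = D" and s: "s \<in> keys P"
    and i: "{i00, i10, i01, i11} = {1..4}" "distinct [i00, i10, i01, i11]"
  shows "weight x_weight s = int m * (weight (row_weight i10) s + weight (row_weight i11) s)"
    and "weight y_weight s = int n * (weight (row_weight i01) s + weight (row_weight i11) s)"
proof -
  let ?V = "{(i00, (0, 0)), (i10, (m, 0)), (i01, (0, n)), (i11, (m, n))}"
  obtain s0 t0 where "keys P \<inter> terms_in ?V = {s0}" "keys Q \<inter> terms_in ?V = {t0}"
    by (rule factor_of_term_in[OF det_corner_term[OF i, folded PQ]])
  then have s0: "s0 \<in> keys P" "keys s0 \<subseteq> ?V" by (auto simp: terms_in_def)
  have wt: "weight f s0 = (\<Sum>v\<in>?V. int (lookup s0 v) * f v)" for f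
    by (rule weight_on) (use s0(2) in auto)
  have "weight x_weight s0 = int m * (weight (row_weight i10) s0 + weight (row_weight i11) s0)"
    "weight y_weight s0 = int n * (weight (row_weight i01) s0 + weight (row_weight i11) s0)"
    unfolding wt using i(2) by (auto simp: algebra_simps)
  then show "weight x_weight s = int m * (weight (row_weight i10) s + weight (row_weight i11) s)"
    and "weight y_weight s = int n * (weight (row_weight i01) s + weight (row_weight i11) s)"
    by (simp_all only: factor_row_degree_const[OF PQ s s0(1)] factor_x_degree_const[OF PQ s s0(1)]
        factor_y_degree_const[OF PQ s s0(1)])
qed

text \<open>
  The corners with \<open>x^m\<close> can be given to any pair, so all sums of two of the four degrees agree.
\<close>

lemma factor_degrees:
  assumes PQ: "P * Q = D" and s: "s \<in> keys P"
  shows "\<exists>k. (\<forall>i\<in>{1..4}. weight (row_weight i) s = k) \<and>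
    weight x_weight s = 2 * int m * k \<and> weight y_weight s = 2 * int n * k"
proof -
  note c = factor_corner_degrees[OF PQ s]
  \<comment> \<open>The two indices in the name of a fact receive the corners with \<open>x^m\<close> (or \<open>y^n\<close>).\<close>
  have x12: "weight x_weight s = int m * (weight (row_weight 1) s + weight (row_weight 2) s)"
    by (rule c(1)[of 3 _ 4]) auto
  have x13: "weight x_weight s = int m * (weight (row_weight 1) s + weight (row_weight 3) s)"
    by (rule c(1)[of 2 _ 4]) auto
  have x23: "weight x_weight s = int m * (weight (row_weight 2) s + weight (row_weight 3) s)"
    by (rule c(1)[of 1 _ 4]) auto
  have x14: "weight x_weight s = int m * (weight (row_weight 1) s + weight (row_weight 4) s)"
    by (rule c(1)[of 2 _ 3]) auto
  have y12: "weight y_weight s = int n * (weight (row_weight 1) s + weight (row_weight 2) s)"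
    by (rule c(2)[of 3 4]) auto
  define k where "k = weight (row_weight 1) s"
  have k: "weight (row_weight 2) s = k" "weight (row_weight 3) s = k" "weight (row_weight 4) s = k"
    using x12 x13 x23 x14 m unfolding k_def by auto
  show ?thesis
  proof (intro exI[of _ k] conjI ballI)
    fix i assume "i \<in> {1..4::nat}"
    then have "i = 1 \<or> i = 2 \<or> i = 3 \<or> i = 4" by auto
    then show "weight (row_weight i) s = k" using k k_def by auto
  next
    show "weight x_weight s = 2 * int m * k" using x12 unfolding k k_def[symmetric] by simp
    show "weight y_weight s = 2 * int n * k" using y12 unfolding k k_def[symmetric] by simp
  qed
qed

text \<open>
  Here \<open>k\<close> is the common degree in the coefficients of the \<open>F\<^sub>i\<close>. Comparing the \<open>y\<close>-degree \<open>2 n k\<close>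
  with the contributions \<open>n k\<close> of \<open>v2\<close> and of \<open>w4\<close> excludes \<open>u1\<close>; then \<open>u2\<close> and \<open>v2\<close> already account
  for the \<open>x\<close>-degree \<open>2 m k\<close>, and \<open>w3\<close> and \<open>w4\<close> exceed it by \<open>2 k\<close>.
\<close>

lemma factor_core_term_degrees:
  assumes PQ: "P * Q = D" and s: "s \<in> keys P" "keys s \<subseteq> core_vars m n" and i: "i \<in> {1..4}"
  shows "weight (row_weight i) s = 0"
proof -
  obtain k where k: "\<And>i. i \<in> {1..4} \<Longrightarrow> weight (row_weight i) s = k"
    "weight x_weight s = 2 * int m * k" "weight y_weight s = 2 * int n * k"
    using factor_degrees[OF PQ s(1)] by blast
  have wt: "weight f s = (\<Sum>v\<in>core_vars m n. int (lookup s v) * f v)" for f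
    by (rule weight_on) (use s(2) in \<open>auto simp: core_vars_def\<close>)
  let ?l = "\<lambda>v. int (lookup s v)"
  have sum: "(\<Sum>v\<in>core_vars m n. h v)
      = h (1, (0, n)) + h (1, (m, 0)) + h (2, (m, n)) + h (3, (1, 0)) + h (4, (1, n))"
    for h :: "nat \<times> (nat \<times> nat) \<Rightarrow> int"
    using m n by (simp add: core_vars_def)
  define a b c d e where abcde: "a = ?l (1, (0, n))" "b = ?l (1, (m, 0))" "c = ?l (2, (m, n))"
    "d = ?l (3, (1, 0))" "e = ?l (4, (1, n))"
  have r: "a + b = k" "c = k" "d = k" "e = k"
    using k(1)[of 1] k(1)[of 2] k(1)[of 3] k(1)[of 4] unfolding wt sum abcde by simp_all
  have "int n * a + int n * c + int n * e = 2 * int n * k"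
    using k(3) unfolding wt sum abcde by (simp add: mult.commute)
  then have "int n * a = 0" unfolding r by simp
  then have "b = k" using n r(1) by simp
  have "int m * b + int m * c + d + e = 2 * int m * k"
    using k(2) unfolding wt sum abcde by (simp add: mult.commute)
  then have "2 * k = 0" unfolding r \<open>b = k\<close> by simp
  then have "k = 0" by simp
  then show ?thesis using k(1)[OF i] by simp
qed

text \<open>
  Setting \<open>v0 = 0\<close> or \<open>u0 = 0\<close> leaves one term of the specialized determinant each, and correspondingly
  one monomial of each factor. The term for \<open>v0 = 0\<close> is linear in \<open>u0\<close>, so \<open>u0\<close> is missing in the
  monomial of one factor. That monomial survives \<open>u0 = 0\<close> as well, so it divides both terms and
  contains neither \<open>v0\<close> nor \<open>v1\<close>.
\<close>

lemma factor_core_term: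
  assumes PQ: "P * Q = D"
  shows "(\<exists>s\<in>keys P. keys s \<subseteq> core_vars m n) \<or> (\<exists>t\<in>keys Q. keys t \<subseteq> core_vars m n)"
proof -
  let ?V1 = "insert (1, (0, 0)) (insert (2, (0, 1)) (core_vars m n))"
  let ?V2 = "insert (2, (0, 0)) (insert (2, (0, 1)) (core_vars m n))"
  let ?M1 = "arrangement_term m n (first_arrangement m n)"
  let ?M2 = "arrangement_term m n (second_arrangement m n)"
  obtain p1 q1 where 1: "keys P \<inter> terms_in ?V1 = {p1}" "keys Q \<inter> terms_in ?V1 = {q1}" "p1 + q1 = ?M1"
    by (rule factor_of_term_in[OF det_first_term(1)[folded PQ]])
  obtain p2 q2 where 2: "keys P \<inter> terms_in ?V2 = {p2}" "keys Q \<inter> terms_in ?V2 = {q2}" "p2 + q2 = ?M2"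
    by (rule factor_of_term_in[OF det_second_term[folded PQ]])
  have M2: "keys ?M2 \<subseteq> insert (2, (0, 0)) (core_vars m n)"
    by (rule arrangement_keys[OF arrangement_second[OF m n]])
  have core: "keys s \<subseteq> core_vars m n"
    if A: "A \<inter> terms_in ?V1 = {s}" "A \<inter> terms_in ?V2 = {s2}" "keys s2 \<subseteq> keys ?M2"
      and u0: "lookup s (1, (0, 0)) = 0" for A s s2
  proof -
    have s: "s \<in> A" "keys s \<subseteq> ?V1" using A(1) by (auto simp: terms_in_def)
    have "(1, (0, 0)) \<notin> keys s" using u0 by (simp add: in_keys_iff)
    then have s': "keys s \<subseteq> insert (2, (0, 1)) (core_vars m n)" using s(2) by blast
    then have "s \<in> A \<inter> terms_in ?V2" using s(1) by (auto simp: terms_in_def)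
    then have "s = s2" unfolding A(2) by simp
    then have "keys s \<subseteq> insert (2, (0, 0)) (core_vars m n)" using A(3) M2 by blast
    then show ?thesis using s' by auto
  qed
  have "lookup p1 (1, (0, 0)) + lookup q1 (1, (0, 0)) \<le> 1"
    using first_arrangement_once[OF m n] unfolding 1(3)[symmetric] lookup_add .
  then consider "lookup p1 (1, (0, 0)) = 0" | "lookup q1 (1, (0, 0)) = 0" by linarith
  then show ?thesis
  proof cases
    case 1
    have "keys p1 \<subseteq> core_vars m n"
      by (rule core[OF \<open>keys P \<inter> terms_in ?V1 = {p1}\<close> 2(1) _ 1]) (simp add: keys_add_nat flip: 2(3))
    then show ?thesis using \<open>keys P \<inter> terms_in ?V1 = {p1}\<close> by blast
  next
    case 2
    have "keys q1 \<subseteq> core_vars m n"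
      by (rule core[OF \<open>keys Q \<inter> terms_in ?V1 = {q1}\<close> \<open>keys Q \<inter> terms_in ?V2 = {q2}\<close> _ 2])
        (simp add: keys_add_nat flip: \<open>p2 + q2 = ?M2\<close>)
    then show ?thesis using \<open>keys Q \<inter> terms_in ?V1 = {q1}\<close> by blast
  qed
qed

text \<open>
  All degrees vanish, so the factor is an integer, and it divides a coefficient \<open>1\<close> or \<open>-1\<close>.
\<close>

lemma factor_with_core_term_unit:
  assumes PQ: "P * Q = D" and P: "P \<in> carrier (Zc m n)"
    and s: "s \<in> keys P" "keys s \<subseteq> core_vars m n"
  shows "P \<in> {1, -1}"
proof -
  have "t = 0" if t: "t \<in> keys P" for t
  proof (rule ccontr)
    assume "t \<noteq> 0"
    then have "keys t \<noteq> {}" by simp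
    then obtain v where v: "v \<in> keys t" by blast
    have tV: "keys t \<subseteq> {1..4} \<times> exponents m n" using P t by (simp add: Zc_def)
    then have i: "fst v \<in> {1..4}" using v by auto
    have "0 < int (lookup t v) * row_weight (fst v) v" using v by (simp add: in_keys_iff)
    also have "\<dots> \<le> weight (row_weight (fst v)) t"
      unfolding weight_def by (rule member_le_sum[OF v]) auto
    also have "\<dots> = weight (row_weight (fst v)) s"
      by (rule factor_row_degree_const[OF PQ t s(1)])
    also have "\<dots> = 0" by (rule factor_core_term_degrees[OF PQ s i])
    finally show False by simp
  qed
  then have "P = single 0 (lookup P 0)"
    by (intro poly_mapping_eqI) (auto simp: lookup_single when_def in_keys_iff)
  then obtain c where c: "P = single 0 c" by blast
  have "lookup (single 0 c * Q) u = c * lookup Q u" for u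
    by (simp flip: mult_map_scale_conv_mult add: Poly_Mapping.map.rep_eq when_def)
  then have "c * lookup Q (arrangement_term m n (first_arrangement m n)) \<in> {1, -1}"
    using det_first_term(2) PQ c by metis
  then have "c dvd 1" by (metis dvd_minus_iff dvd_triv_left insertE singletonD)
  then have "c = 1 \<or> c = -1" by (simp add: zdvd1_eq abs_if split: if_splits)
  then show ?thesis using c by (auto simp flip: single_one simp: single_uminus)
qed

lemma det_carrier: "D \<in> carrier (Zc m n)"
proof -
  have "keys t \<subseteq> {1..4} \<times> exponents m n" if t: "t \<in> keys D" for t
  proof -
    obtain g where g: "arrangement m n ({1..4} \<times> exponents m n) g" "arrangement_term m n g = t"
      using det_term_arrangement[OF m n rs cs] t unfolding D_def by blast
    show ?thesis using arrangement_keys[OF g(1)] g(2) by simp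
  qed
  then show ?thesis by (simp add: Zc_def)
qed

lemma det_not_unit:
  assumes "D * E = 1"
  shows False
proof -
  have "keys (D * E) = {0}" by (simp add: assms)
  then obtain s t where st: "keys D = {s}" "s + t = 0" by (rule factor_of_term)
  have "keys s = {}" using keys_add_nat[of s t] st(2) by simp
  moreover have "arrangement_term m n (first_arrangement m n) \<in> keys D"
    using equalityD2[OF det_first_term(1)] by simp
  then have "s = arrangement_term m n (first_arrangement m n)" unfolding st(1) by simp
  ultimately have "exponents (2 * m - 1) (2 * n - 1) = {}"
    using keys_arrangement_term[of m n "first_arrangement m n"] by simp
  then show False by (simp add: exponents_def)
qed

lemma det_irreducible: "ring_irreducible\<^bsub>Zc m n\<^esub> D"
proof -
  have ops: "x \<otimes>\<^bsub>Zc m n\<^esub> y = x * y" "\<one>\<^bsub>Zc m n\<^esub> = 1" "\<zero>\<^bsub>Zc m n\<^esub> = 0" for x y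
    by (auto simp: Zc_def)
  have unit: "x \<in> Units (Zc m n)" if "x \<in> {1, -1}" "x \<in> carrier (Zc m n)" for x
  proof -
    have "x * x = 1" using that(1) by auto
    then show ?thesis using that(2) by (auto simp: Units_def ops)
  qed
  show ?thesis
    unfolding ring_irreducible_def Divisibility.irreducible_def ops
  proof (intro conjI ballI impI)
    show "D \<noteq> 0" by (rule det_nonzero)
    show "D \<notin> Units (Zc m n)" using det_not_unit by (auto simp: Units_def ops)
  next
    fix P assume P: "P \<in> carrier (Zc m n)" and proper: "properfactor (Zc m n) P D"
    then obtain Q where Q: "Q \<in> carrier (Zc m n)" and PQ: "P * Q = D"
      by (auto simp: properfactor_def factor_def ops)
    from factor_core_term[OF PQ] show "P \<in> Units (Zc m n)"
    proof
      assume "\<exists>s\<in>keys P. keys s \<subseteq> core_vars m n"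
      then show "P \<in> Units (Zc m n)" using factor_with_core_term_unit[OF PQ P] unit[OF _ P] by blast
    next
      assume "\<exists>t\<in>keys Q. keys t \<subseteq> core_vars m n"
      then have "Q \<in> {1, -1}"
        using factor_with_core_term_unit[OF _ Q, of P] PQ by (auto simp: mult.commute)
      then have "P = D * Q" using PQ by auto
      then have "D divides\<^bsub>Zc m n\<^esub> P" using Q by (auto simp: factor_def ops)
      then show "P \<in> Units (Zc m n)" using proper by (simp add: properfactor_def)
    qed
  qed
qed

end

theorem theorem1p1:
  fixes m n :: nat
    and rs :: "(nat \<times> nat) list"
    and cs :: "(nat \<times> (nat \<times> nat)) list"
  assumes "0 < m" and "0 < n"
    and "is_enumeration rs (exponents (2 * m - 1) (2 * n - 1))"
    and "is_enumeration cs ({1..4} \<times> exponents (m - 1) (n - 1))"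
  shows "Determinant.det (syl_mat (generic_poly m n) rs cs) \<in> carrier (Zc m n) \<and>
    ring_irreducible\<^bsub>Zc m n\<^esub> (Determinant.det (syl_mat (generic_poly m n) rs cs))"
  using det_carrier[OF assms] det_irreducible[OF assms] ..

end
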